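(* Let $q$ be real and nonzero and let $s=\imath t$ where $t\neq 0$ is real. Then the Podleś $2$-sphere with parameters $(q^2,s^2)=(q^2,-t^2)$ is isomorphic as a $*$-algebra to the "time slice" of $B_q[SU_2]$, i.e. to the quotient of $B_q[SU_2]$ by the relation $\mathrm{Tr}_q(u)=t+t^{-1}$. Moreover, when $t^2\neq 1$, the tautological projector $e$ and the parameter $\lambda$ of the $q$-fuzzy sphere presentation of this Podleś sphere take the form $$e=\frac{1-qt\,u}{1-t^2},\qquad \lambda=t^2\,\frac{1-q^2}{1-t^2},$$ where $u$ is the matrix of generators of $B_q[SU_2]$ (with entries taken in the time slice).
   Context: All algebras are unital $*$-algebras over $\mathbb{C}$ given by generators and relations (adjoints of the listed relations also imposed). Podleś sphere with real parameters $q^2\neq0$, $s^2$: generators $x=x^*,z,z^*$; relations $zx=q^2xz$, $zz^*=(s^2+q^2x)(1-q^2x)$, $z^*z=(s^2+x)(1-x)$. $B_q[SU_2]$ (unit hyperboloid in $q$-Minkowski space): matrix of generators $u=\begin{pmatrix}\alpha&\beta\\ \beta^*&\delta\end{pmatrix}$ with $\alpha^*=\alpha$, $\delta^*=\delta$ and relations $$\beta\alpha=q^2\alpha\beta,\quad \delta\alpha=\alpha\delta,\quad [\beta,\beta^*]=(1-q^{-2})\alpha(\delta-\alpha),\quad [\delta,\beta]=(1-q^{-2})\alpha\beta,\quad \alpha\delta-q^2\beta^*\beta=1.$$ The element $\mathrm{Tr}_q(u)=q^{-1}\alpha+q\delta$ is central. $q$-fuzzy sphere with real parameters $q^2\ne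 0,\lambda$: generators $a=a^*,b,b^*$, with relations saying that the tautological matrix $e=\begin{pmatrix}1+\lambda-q^2a&b\\ b^*&a\end{pmatrix}$ satisfies $e^2=e$; thus $e^\dagger=e$ and $\mathrm{trace}_q(e):=e_{11}+q^2e_{22}=1+\lambda$. Explicitly: $q^2ab-ba=\lambda b$, $bb^*=(q^2a-\lambda)(1+\lambda-q^2a)$, $b^*b=a(1-a)$. The statement about $e$ and $\lambda$ means that the time slice is isomorphic to the $q$-fuzzy sphere with the given $\lambda$ in such a way that the tautological projector of the latter corresponds to the given matrix $e$. *)

theory Defs
  imports
    "HOL-Library.Poly_Mapping"
    "HOL-Algebra.QuotRing"
    "HOL-Algebra.Module"
    "HOL-Analysis.Cartesian_Space"
begin

section \<open>Unital *-algebras over the complex numbers\<close>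

record 'a star_algebra = "(complex, 'a) module" +
  star :: "'a \<Rightarrow> 'a"

locale star_algebra = ring A for A (structure) +
  assumes smult_closed: "x \<in> carrier A \<Longrightarrow> c \<odot> x \<in> carrier A"
    and smult_l_distr: "x \<in> carrier A \<Longrightarrow> (c + d) \<odot> x = c \<odot> x \<oplus> d \<odot> x"
    and smult_r_distr: "\<lbrakk>x \<in> carrier A; y \<in> carrier A\<rbrakk> \<Longrightarrow> c \<odot> (x \<oplus> y) = c \<odot> x \<oplus> c \<odot> y"
    and smult_assoc: "x \<in> carrier A \<Longrightarrow> (c * d) \<odot> x = c \<odot> (d \<odot> x)"
    and smult_one: "x \<in> carrier A \<Longrightarrow> 1 \<odot> x = x"
    and smult_mult_l: "\<lbrakk>x \<in> carrier A; y \<in> carrier A\<rbrakk> \<Longrightarrow> (c \<odot> x) \<otimes> y = c \<odot> (x \<otimes> y)"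
    and smult_mult_r: "\<lbrakk>x \<in> carrier A; y \<in> carrier A\<rbrakk> \<Longrightarrow> x \<otimes> (c \<odot> y) = c \<odot> (x \<otimes> y)"
    and star_closed: "x \<in> carrier A \<Longrightarrow> star A x \<in> carrier A"
    and star_add: "\<lbrakk>x \<in> carrier A; y \<in> carrier A\<rbrakk> \<Longrightarrow> star A (x \<oplus> y) = star A x \<oplus> star A y"
    and star_mult: "\<lbrakk>x \<in> carrier A; y \<in> carrier A\<rbrakk> \<Longrightarrow> star A (x \<otimes> y) = star A y \<otimes> star A x"
    and star_smult: "x \<in> carrier A \<Longrightarrow> star A (c \<odot> x) = cnj c \<odot> star A x"
    and star_star: "x \<in> carrier A \<Longrightarrow> star A (star A x) = x"

definition star_algebra_iso ::
    "('a, 'c) star_algebra_scheme \<Rightarrow> ('b, 'd) star_algebra_scheme \<Rightarrow> ('a \<Rightarrow> 'b) set" where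
  "star_algebra_iso A B = {h \<in> ring_iso A B.
     (\<forall>c. \<forall>x \<in> carrier A. h (c \<odot>\<^bsub>A\<^esub> x) = c \<odot>\<^bsub>B\<^esub> h x) \<and>
     (\<forall>x \<in> carrier A. h (star A x) = star B (h x))}"

text \<open>
  The two-sided ideal generated by \<open>S\<close> and the adjoints of its elements. It is automatically closed
  under scalar multiplication, the algebra being unital.
\<close>

definition star_ideal :: "('a, 'c) star_algebra_scheme \<Rightarrow> 'a set \<Rightarrow> 'a set" where
  "star_ideal A S = Idl\<^bsub>A\<^esub> (S \<union> star A ` S)"

definition star_proj :: "('a, 'c) star_algebra_scheme \<Rightarrow> 'a set \<Rightarrow> 'a \<Rightarrow> 'a set" where
  "star_proj A S x = star_ideal A S +>\<^bsub>A\<^esub> x"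

definition star_quotient :: "('a, 'c) star_algebra_scheme \<Rightarrow> 'a set \<Rightarrow> 'a set star_algebra" where
  "star_quotient A S =
    \<lparr>carrier = carrier (A Quot star_ideal A S),
     mult = mult (A Quot star_ideal A S),
     one = one (A Quot star_ideal A S),
     zero = zero (A Quot star_ideal A S),
     add = add (A Quot star_ideal A S),
     smult = (\<lambda>c X. \<Union>x\<in>X. star_proj A S (c \<odot>\<^bsub>A\<^esub> x)),
     star = (\<lambda>X. \<Union>x\<in>X. star_proj A S (star A x))\<rparr>"


section \<open>Free *-algebras\<close>

datatype 'g letter = Gen 'g | Gen_star 'g

fun letter_star :: "'g letter \<Rightarrow> 'g letter" where
  "letter_star (Gen g) = Gen_star g"
| "letter_star (Gen_star g) = Gen g"

datatype 'g word = Word (letters: "'g letter list")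

text \<open>The free monoid, written additively because \<^typ>\<open>'g word \<Rightarrow>\<^sub>0 complex\<close> is then its monoid algebra.\<close>

instantiation word :: (type) monoid_add
begin

definition zero_word :: "'a word" where
  "0 = Word []"

definition plus_word :: "'a word \<Rightarrow> 'a word \<Rightarrow> 'a word" where
  "v + w = Word (letters v @ letters w)"

instance
  by standard (simp_all add: zero_word_def plus_word_def)

end

type_synonym 'g free_algebra = "'g word \<Rightarrow>\<^sub>0 complex"

definition word_star :: "'g word \<Rightarrow> 'g word" where
  "word_star w = Word (rev (map letter_star (letters w)))"

definition gen :: "'g \<Rightarrow> 'g free_algebra" where
  "gen g = Poly_Mapping.single (Word [Gen g]) 1"

definition scal :: "complex \<Rightarrow> 'g free_algebra" where
  "scal c = Poly_Mapping.single 0 c"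

definition adj :: "'g free_algebra \<Rightarrow> 'g free_algebra" where
  "adj p = (\<Sum>w\<in>Poly_Mapping.keys p.
     Poly_Mapping.single (word_star w) (cnj (Poly_Mapping.lookup p w)))"

definition free_star_algebra :: "'g free_algebra star_algebra" where
  "free_star_algebra =
    \<lparr>carrier = UNIV, mult = (*), one = 1, zero = 0, add = (+),
     smult = (\<lambda>c p. scal c * p), star = adj\<rparr>"

definition presented_star_algebra :: "'g free_algebra set \<Rightarrow> 'g free_algebra set star_algebra" where
  "presented_star_algebra S = star_quotient free_star_algebra S"


section \<open>The algebras\<close>

subsection \<open>Podles sphere\<close>

datatype podles_gen = Pod_x | Pod_z

text \<open>The real parameters \<open>q2\<close> and \<open>s2\<close> stand for $q^2$ and $s^2$; \<open>s2\<close> may be negative.\<close>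

definition podles_rels :: "real \<Rightarrow> real \<Rightarrow> podles_gen free_algebra set" where
  "podles_rels q2 s2 =
    (let x = gen Pod_x; z = gen Pod_z in
      {x - adj x,
       z * x - scal q2 * x * z,
       z * adj z - (scal s2 + scal q2 * x) * (1 - scal q2 * x),
       adj z * z - (scal s2 + x) * (1 - x)})"

definition podles_sphere :: "real \<Rightarrow> real \<Rightarrow> podles_gen free_algebra set star_algebra" where
  "podles_sphere q2 s2 = presented_star_algebra (podles_rels q2 s2)"


subsection \<open>The braided hyperboloid $B_q[SU_2]$ and its time slices\<close>

datatype hyp_gen = Hyp_alpha | Hyp_beta | Hyp_delta

definition hyp_rels :: "real \<Rightarrow> hyp_gen free_algebra set" where
  "hyp_rels q =
    (let \<alpha> = gen Hyp_alpha; \<beta> = gen Hyp_beta; \<delta> = gen Hyp_delta; k = scal (1 - 1 / q\<^sup>2) in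
      {\<alpha> - adj \<alpha>,
       \<delta> - adj \<delta>,
       \<beta> * \<alpha> - scal (q\<^sup>2) * \<alpha> * \<beta>,
       \<delta> * \<alpha> - \<alpha> * \<delta>,
       (\<beta> * adj \<beta> - adj \<beta> * \<beta>) - k * \<alpha> * (\<delta> - \<alpha>),
       (\<delta> * \<beta> - \<beta> * \<delta>) - k * \<alpha> * \<beta>,
       (\<alpha> * \<delta> - scal (q\<^sup>2) * adj \<beta> * \<beta>) - 1})"

definition BqSU2 :: "real \<Rightarrow> hyp_gen free_algebra set star_algebra" where
  "BqSU2 q = presented_star_algebra (hyp_rels q)"

definition BqSU2_u :: "real \<Rightarrow> hyp_gen free_algebra set ^ 2 ^ 2" where
  "BqSU2_u q =
    (let u = vector [vector [gen Hyp_alpha, gen Hyp_beta],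
                     vector [adj (gen Hyp_beta), gen Hyp_delta]] :: hyp_gen free_algebra ^ 2 ^ 2
     in \<chi> i j. star_proj free_star_algebra (hyp_rels q) (u $ i $ j))"

definition Tr_q :: "real \<Rightarrow> hyp_gen free_algebra set" where
  "Tr_q q = complex_of_real (inverse q) \<odot>\<^bsub>BqSU2 q\<^esub> (BqSU2_u q $ 1 $ 1)
              \<oplus>\<^bsub>BqSU2 q\<^esub> complex_of_real q \<odot>\<^bsub>BqSU2 q\<^esub> (BqSU2_u q $ 2 $ 2)"

definition slice_rels :: "real \<Rightarrow> real \<Rightarrow> hyp_gen free_algebra set set" where
  "slice_rels q t =
    {Tr_q q \<ominus>\<^bsub>BqSU2 q\<^esub> complex_of_real (t + inverse t) \<odot>\<^bsub>BqSU2 q\<^esub> \<one>\<^bsub>BqSU2 q\<^esub>}"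

definition time_slice :: "real \<Rightarrow> real \<Rightarrow> hyp_gen free_algebra set set star_algebra" where
  "time_slice q t = star_quotient (BqSU2 q) (slice_rels q t)"

definition time_slice_u :: "real \<Rightarrow> real \<Rightarrow> hyp_gen free_algebra set set ^ 2 ^ 2" where
  "time_slice_u q t = (\<chi> i j. star_proj (BqSU2 q) (slice_rels q t) (BqSU2_u q $ i $ j))"


subsection \<open>The q-fuzzy sphere\<close>

datatype fuzzy_gen = Fuz_a | Fuz_b

definition fuzzy_free_e :: "real \<Rightarrow> real \<Rightarrow> fuzzy_gen free_algebra ^ 2 ^ 2" where
  "fuzzy_free_e q2 lam =
    vector [vector [1 + scal lam - scal q2 * gen Fuz_a, gen Fuz_b],
            vector [adj (gen Fuz_b), gen Fuz_a]]"

definition fuzzy_rels :: "real \<Rightarrow> real \<Rightarrow> fuzzy_gen free_algebra set" where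
  "fuzzy_rels q2 lam =
    (let e = fuzzy_free_e q2 lam in
      {gen Fuz_a - adj (gen Fuz_a)} \<union> {(e ** e) $ i $ j - e $ i $ j | i j. True})"

definition fuzzy_sphere :: "real \<Rightarrow> real \<Rightarrow> fuzzy_gen free_algebra set star_algebra" where
  "fuzzy_sphere q2 lam = presented_star_algebra (fuzzy_rels q2 lam)"

definition fuzzy_e :: "real \<Rightarrow> real \<Rightarrow> fuzzy_gen free_algebra set ^ 2 ^ 2" where
  "fuzzy_e q2 lam =
    (\<chi> i j. star_proj free_star_algebra (fuzzy_rels q2 lam) (fuzzy_free_e q2 lam $ i $ j))"


section \<open>Well-definedness of the constructions\<close>

lemma letter_star_letter_star [simp]: "letter_star (letter_star l) = l"
  by (cases l) simp_all

lemma word_star_word_star [simp]: "word_star (word_star w) = w"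
  by (simp add: word_star_def rev_map comp_def)

lemma word_star_plus: "word_star (v + w) = word_star w + word_star v"
  by (simp add: word_star_def plus_word_def)

lemma word_star_zero [simp]: "word_star 0 = 0"
  by (simp add: word_star_def zero_word_def)

lemma lookup_adj: "Poly_Mapping.lookup (adj p) w = cnj (Poly_Mapping.lookup p (word_star w))"
proof -
  have "Poly_Mapping.lookup (adj p) w =
      (\<Sum>v\<in>Poly_Mapping.keys p. if v = word_star w then cnj (Poly_Mapping.lookup p v) else 0)"
    unfolding adj_def lookup_sum
    by (rule sum.cong) (auto simp: lookup_single when_def)
  also have "\<dots> = cnj (Poly_Mapping.lookup p (word_star w))"
    by (auto simp: sum.delta in_keys_iff)
  finally show ?thesis .
qed

lemma adj_add: "adj (p + r) = adj p + adj r"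
  by (rule poly_mapping_eqI) (simp add: lookup_adj lookup_add)

lemma adj_zero [simp]: "adj 0 = 0"
  by (simp add: adj_def)

lemma adj_adj [simp]: "adj (adj p) = p"
  by (rule poly_mapping_eqI) (simp add: lookup_adj)

lemma adj_single: "adj (Poly_Mapping.single w c) = Poly_Mapping.single (word_star w) (cnj c)"
  by (rule poly_mapping_eqI) (auto simp: lookup_adj lookup_single when_def)

lemma free_algebra_induct [case_names zero add]:
  assumes "P 0" and "\<And>p w c. P p \<Longrightarrow> P (Poly_Mapping.single w c + p)"
  shows "P (p :: 'g free_algebra)"
proof (induction p rule: update_induct)
  case const
  show ?case by (rule assms)
next
  case (update f a b)
  have "Poly_Mapping.update a b f = Poly_Mapping.single a b + f"
    using update by (intro poly_mapping_eqI)
      (auto simp: lookup_update lookup_add lookup_single when_def in_keys_iff)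
  with update assms(2) show ?case by simp
qed

lemma adj_mult: "adj (p * r) = adj r * adj p"
proof (induction p rule: free_algebra_induct)
  case zero
  show ?case by simp
next
  case (add p w c)
  have "adj (Poly_Mapping.single w c * r) = adj r * adj (Poly_Mapping.single w c)"
    by (induction r rule: free_algebra_induct)
      (simp_all add: distrib_left distrib_right adj_add adj_single mult_single word_star_plus mult.commute)
  with add show ?case
    by (simp add: distrib_left distrib_right adj_add)
qed

lemma scal_add: "scal (c + d) = scal c + scal d"
  by (simp add: scal_def single_add)

lemma scal_mult: "scal (c * d) = scal c * scal d"
  by (simp add: scal_def mult_single)

lemma scal_one [simp]: "scal 1 = 1"
  by (simp add: scal_def)

lemma adj_scal: "adj (scal c) = scal (cnj c)"
  by (simp add: scal_def adj_single)

lemma scal_commute: "p * scal c = scal c * p"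
  by (induction p rule: free_algebra_induct)
    (simp_all add: scal_def distrib_left distrib_right mult_single mult.commute)

lemma free_star_algebra: "star_algebra (free_star_algebra :: 'g free_algebra star_algebra)"
proof -
  have "\<exists>y. y + x = 0" for x :: "'g free_algebra"
    by (rule exI[of _ "- x"]) simp
  then have "abelian_group (free_star_algebra :: 'g free_algebra star_algebra)"
    by (intro abelian_groupI) (simp_all add: free_star_algebra_def add_ac)
  moreover have "Group.monoid (free_star_algebra :: 'g free_algebra star_algebra)"
    by (rule monoidI) (simp_all add: free_star_algebra_def mult.assoc)
  ultimately have ring: "ring (free_star_algebra :: 'g free_algebra star_algebra)"
    by (intro ringI) (simp_all add: free_star_algebra_def distrib_left distrib_right)
  have left: "x * (scal c * y) = scal c * (x * y)" for c and x y :: "'g free_algebra"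
    using scal_commute[of x c] by (simp flip: mult.assoc)
  have adj: "adj (scal c * x) = scal (cnj c) * adj x" for c and x :: "'g free_algebra"
    by (simp add: adj_mult adj_scal scal_commute[of "adj x"])
  show ?thesis
    by (intro star_algebra.intro star_algebra_axioms.intro ring)
      (simp_all add: free_star_algebra_def scal_add scal_mult distrib_left distrib_right mult.assoc
        adj_add, (rule left adj adj_mult)+)
qed

context star_algebra
begin

lemma star_ideal_ideal:
  assumes "S \<subseteq> carrier A"
  shows "ideal (star_ideal A S) A"
  unfolding star_ideal_def using assms star_closed by (intro genideal_ideal) auto

lemma star_zero: "star A \<zero> = \<zero>"
proof -
  have "star A \<zero> = star A \<zero> \<oplus> star A \<zero>"
    using star_add[of \<zero> \<zero>] by simp
  then show ?thesis
    using star_closed[of \<zero>] add.l_cancel_one' by simp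
qed

lemma star_a_inv:
  assumes "x \<in> carrier A"
  shows "star A (\<ominus> x) = \<ominus> star A x"
proof -
  have "star A (\<ominus> x) \<oplus> star A x = \<zero>"
    using star_add[of "\<ominus> x" x] assms by (simp add: l_neg star_zero)
  then show ?thesis
    using minus_equality[of "star A (\<ominus> x)" "star A x"] assms by (simp add: star_closed)
qed

lemma star_ideal_star:
  assumes S: "S \<subseteq> carrier A" and x: "x \<in> star_ideal A S"
  shows "star A x \<in> star_ideal A S"
proof -
  interpret I: ideal "star_ideal A S" A
    by (rule star_ideal_ideal[OF S])
  let ?J = "{x \<in> carrier A. star A x \<in> star_ideal A S}"
  have gens: "S \<union> star A ` S \<subseteq> star_ideal A S"
    unfolding star_ideal_def using S star_closed by (intro genideal_self) auto
  have J: "ideal ?J A"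
  proof (rule idealI)
    show "ring A" by (rule ring_axioms)
    show "subgroup ?J (add_monoid A)"
    proof (rule add.subgroupI)
      show "?J \<noteq> {}"
        using star_zero by auto
      show "\<ominus> y \<in> ?J" if "y \<in> ?J" for y
        using that by (simp add: star_a_inv)
    qed (auto simp: star_add)
  qed (auto simp: star_mult star_closed I.I_l_closed I.I_r_closed)
  have "S \<union> star A ` S \<subseteq> ?J"
    using S gens by (auto simp: star_closed star_star subset_iff)
  then have "star_ideal A S \<subseteq> ?J"
    unfolding star_ideal_def[of A S] using genideal_minimal[OF J] by (simp add: star_ideal_def)
  with x show ?thesis by auto
qed

lemma star_ideal_smult:
  assumes S: "S \<subseteq> carrier A" and x: "x \<in> star_ideal A S"
  shows "c \<odot> x \<in> star_ideal A S"
proof -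
  interpret I: ideal "star_ideal A S" A
    by (rule star_ideal_ideal[OF S])
  have "c \<odot> x = (c \<odot> \<one>) \<otimes> x"
    using x by (simp add: smult_mult_l)
  with x show ?thesis
    by (simp add: I.I_l_closed smult_closed)
qed

lemma coset_map:
  assumes S: "S \<subseteq> carrier A" and x: "x \<in> carrier A"
    and f: "\<And>y z. \<lbrakk>y \<in> carrier A; z \<in> carrier A\<rbrakk> \<Longrightarrow> f (y \<oplus> z) = f y \<oplus> f z"
    and fc: "\<And>y. y \<in> carrier A \<Longrightarrow> f y \<in> carrier A"
    and fI: "\<And>y. y \<in> star_ideal A S \<Longrightarrow> f y \<in> star_ideal A S"
  shows "(\<Union>y\<in>star_proj A S x. star_proj A S (f y)) = star_proj A S (f x)"
proof -
  interpret I: ideal "star_ideal A S" A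
    by (rule star_ideal_ideal[OF S])
  have "star_proj A S (f y) = star_proj A S (f x)" if y: "y \<in> star_proj A S x" for y
  proof -
    obtain h where h: "h \<in> star_ideal A S" "y = h \<oplus> x"
      using y by (auto simp: star_proj_def a_r_coset_def')
    then have "f y = f h \<oplus> f x"
      using x by (simp add: f)
    then have "f y \<in> star_ideal A S +> f x"
      using fI[OF h(1)] by (auto simp: a_r_coset_def')
    then show ?thesis
      unfolding star_proj_def using I.a_repr_independence'[of "f y" "f x"] fc x by simp
  qed
  moreover have "x \<in> star_proj A S x"
    unfolding star_proj_def by (rule I.a_rcos_self[OF x])
  ultimately show ?thesis by blast
qed

lemma
  assumes S: "S \<subseteq> carrier A" and x: "x \<in> carrier A"
  shows smult_star_proj: "c \<odot>\<^bsub>star_quotient A S\<^esub> star_proj A S x = star_proj A S (c \<odot> x)"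
    and star_star_proj: "star (star_quotient A S) (star_proj A S x) = star_proj A S (star A x)"
  using coset_map[OF S x, of "\<lambda>y. c \<odot> y"] coset_map[OF S x, of "star A"]
    star_ideal_smult[OF S] star_ideal_star[OF S]
  by (simp_all add: star_quotient_def smult_r_distr smult_closed star_add star_closed)

lemma
  assumes S: "S \<subseteq> carrier A" and x: "x \<in> carrier A" and y: "y \<in> carrier A"
  shows mult_star_proj:
      "star_proj A S x \<otimes>\<^bsub>star_quotient A S\<^esub> star_proj A S y = star_proj A S (x \<otimes> y)"
    and add_star_proj:
      "star_proj A S x \<oplus>\<^bsub>star_quotient A S\<^esub> star_proj A S y = star_proj A S (x \<oplus> y)"
proof -
  interpret I: ideal "star_ideal A S" A
    by (rule star_ideal_ideal[OF S])
  show "star_proj A S x \<otimes>\<^bsub>star_quotient A S\<^esub> star_proj A S y = star_proj A S (x \<otimes> y)"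
    using I.rcoset_mult_add[OF x y] by (simp add: star_quotient_def star_proj_def FactRing_def)
  show "star_proj A S x \<oplus>\<^bsub>star_quotient A S\<^esub> star_proj A S y = star_proj A S (x \<oplus> y)"
    using I.a_rcos_sum[OF x y] by (simp add: star_quotient_def star_proj_def FactRing_def)
qed

lemma carrier_star_quotient: "carrier (star_quotient A S) = star_proj A S ` carrier A"
  by (auto simp: star_quotient_def FactRing_simps star_proj_def)

lemma star_quotient_star_algebra:
  assumes S: "S \<subseteq> carrier A"
  shows "star_algebra (star_quotient A S)"
proof -
  interpret I: ideal "star_ideal A S" A
    by (rule star_ideal_ideal[OF S])
  interpret Q: ring "A Quot star_ideal A S"
    by (rule I.quotient_is_ring)
  have "abelian_group (star_quotient A S)"
    by (rule abelian_groupI)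
      (use Q.add.l_inv_ex in \<open>auto simp: star_quotient_def Q.a_assoc Q.a_comm Q.a_lcomm\<close>)
  moreover have "Group.monoid (star_quotient A S)"
    by (rule monoidI) (auto simp: star_quotient_def Q.m_assoc)
  ultimately have "ring (star_quotient A S)"
    by (rule ringI) (auto simp: star_quotient_def Q.l_distr Q.r_distr)
  then show ?thesis
    using S
    by (intro star_algebra.intro star_algebra_axioms.intro)
      (auto simp: carrier_star_quotient smult_star_proj star_star_proj mult_star_proj add_star_proj
        smult_closed star_closed smult_l_distr smult_r_distr smult_assoc smult_one
        smult_mult_l smult_mult_r star_add star_mult star_smult star_star)
qed

end

lemma presented_star_algebra: "star_algebra (presented_star_algebra S)"
  unfolding presented_star_algebra_def
  by (rule star_algebra.star_quotient_star_algebra[OF free_star_algebra])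
    (simp add: free_star_algebra_def)

lemma time_slice_star_algebra: "star_algebra (time_slice q t)"
proof -
  interpret B: star_algebra "BqSU2 q"
    unfolding BqSU2_def by (rule presented_star_algebra)
  have u: "BqSU2_u q $ i $ j \<in> carrier (BqSU2 q)" for i j
    unfolding BqSU2_u_def BqSU2_def presented_star_algebra_def
      star_algebra.carrier_star_quotient[OF free_star_algebra]
    by (simp add: Let_def) (simp add: free_star_algebra_def)
  then have "slice_rels q t \<subseteq> carrier (BqSU2 q)"
    by (simp add: slice_rels_def Tr_q_def B.smult_closed)
  then show ?thesis
    unfolding time_slice_def by (rule B.star_quotient_star_algebra)
qed

end

theory Submission
  imports Defs
begin

text \<open>
  In the time slice $\delta = q^{-1}(t + t^{-1}) - q^{-2}\alpha$, and the remaining relations of the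
  hyperboloid become $\beta\alpha = q^2\alpha\beta$ together with the factorizations
  $q^2\beta^*\beta = -(1 - q^{-1}t\alpha)(1 - q^{-1}t^{-1}\alpha)$ and
  $q^2\beta\beta^* = -(1 - qt\alpha)(1 - qt^{-1}\alpha)$. These are the relations of the Podles
  sphere under $x = q^{-1}t\alpha$, $z = qt\beta$. For $t^2 \neq 1$ the q-fuzzy sphere is the same
  algebra in the affine coordinates $a = (x - t^2)/(1 - t^2)$, $b = -z/(1 - t^2)$.
  Each substitution sends the defining relations to explicit two-sided combinations of the
  relations on the other side.
\<close>

section \<open>Homomorphisms and quotients\<close>

text \<open>The scale of \<open>x\<close> is fixed by making 1 a root of the quadratic that
  expresses \<open>adj z * z\<close>. The other root is then t^2, whence s^2 = -t^2; normalizing the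
  other factor instead would replace t by 1/t. The factor q t in \<open>z\<close> then makes the
  leading coefficients agree.

  Elements of the time slice are cosets of cosets, whereas the Podles and q-fuzzy spheres are single
  quotients of free algebras. The predicate \<open>presents\<close> puts all three on the same
  footing, and an isomorphism becomes a pair of substitutions between free algebras that respect the
  relations and are mutually inverse modulo them. Thus no basis of any quotient has to be known:
  every verification is an identity in a free algebra that exhibits the image of a relation as a
  combination of relations.\<close>

definition star_hom ::
    "('a, 'c) star_algebra_scheme \<Rightarrow> ('b, 'd) star_algebra_scheme \<Rightarrow> ('a \<Rightarrow> 'b) set" where
  "star_hom A B = {h \<in> ring_hom A B.
     (\<forall>c. \<forall>x \<in> carrier A. h (c \<odot>\<^bsub>A\<^esub> x) = c \<odot>\<^bsub>B\<^esub> h x) \<and>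
     (\<forall>x \<in> carrier A. h (star A x) = star B (h x))}"

lemma star_homD:
  assumes "h \<in> star_hom A B"
  shows "h \<in> ring_hom A B"
    and "x \<in> carrier A \<Longrightarrow> h (c \<odot>\<^bsub>A\<^esub> x) = c \<odot>\<^bsub>B\<^esub> h x"
    and "x \<in> carrier A \<Longrightarrow> h (star A x) = star B (h x)"
  using assms by (auto simp: star_hom_def)

lemma star_hom_comp: "\<lbrakk>g \<in> star_hom A B; h \<in> star_hom B C\<rbrakk> \<Longrightarrow> h \<circ> g \<in> star_hom A C"
  using ring_hom_trans[of g A B h C] ring_hom_closed[of g A B] by (simp add: star_hom_def)

lemma star_algebra_iso_iff:
  "h \<in> star_algebra_iso A B \<longleftrightarrow> h \<in> star_hom A B \<and> bij_betw h (carrier A) (carrier B)"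
  by (auto simp: star_algebra_iso_def star_hom_def ring_iso_def)

lemma star_algebra_iso_trans:
  "\<lbrakk>g \<in> star_algebra_iso A B; h \<in> star_algebra_iso B C\<rbrakk> \<Longrightarrow> h \<circ> g \<in> star_algebra_iso A C"
  unfolding star_algebra_iso_iff by (blast intro: star_hom_comp bij_betw_trans)

text \<open>The kernel is an ideal, and it contains the adjoints of elements of \<open>S\<close>
  because \<open>h\<close> carries \<open>star A y\<close> to the adjoint of zero. So only the
  relations themselves have to be checked, never their adjoints.\<close>

lemma star_ideal_subset_kernel:
  assumes A: "star_algebra A" and B: "star_algebra B" and h: "h \<in> star_hom A B"
    and S: "S \<subseteq> carrier A" and 0: "\<And>x. x \<in> S \<Longrightarrow> h x = \<zero>\<^bsub>B\<^esub>"
    and x: "x \<in> star_ideal A S"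
  shows "h x = \<zero>\<^bsub>B\<^esub>"
proof -
  interpret A: star_algebra A by fact
  interpret B: star_algebra B by fact
  interpret h: ring_hom_ring A B h
    by (rule ring_hom_ringI2[OF A.ring_axioms B.ring_axioms star_homD(1)[OF h]])
  have "y \<in> a_kernel A B h \<and> star A y \<in> a_kernel A B h" if "y \<in> S" for y
  proof -
    have y: "y \<in> carrier A" "h y = \<zero>\<^bsub>B\<^esub>"
      using that S 0 by blast+
    have "h (star A y) = \<zero>\<^bsub>B\<^esub>"
      using star_homD(3)[OF h y(1)] y(2) B.star_zero by argo
    then show ?thesis
      unfolding a_kernel_def' using y A.star_closed[OF y(1)] by blast
  qed
  then have "S \<union> star A ` S \<subseteq> a_kernel A B h" by blast
  then have "star_ideal A S \<subseteq> a_kernel A B h"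
    unfolding star_ideal_def by (rule A.genideal_minimal[OF h.kernel_is_ideal])
  with x have "x \<in> a_kernel A B h" by blast
  then show ?thesis unfolding a_kernel_def' by blast
qed

context star_algebra
begin

lemma star_ideal_self: "S \<subseteq> carrier A \<Longrightarrow> S \<subseteq> star_ideal A S"
  unfolding star_ideal_def using genideal_self[of "S \<union> star A ` S"] star_closed by auto

lemma star_proj_hom:
  assumes S: "S \<subseteq> carrier A"
  shows "star_proj A S \<in> star_hom A (star_quotient A S)"
proof -
  have "star_proj A S \<one> = \<one>\<^bsub>star_quotient A S\<^esub>"
    by (simp add: star_quotient_def star_proj_def FactRing_simps)
  then show ?thesis
    using S by (auto simp: star_hom_def carrier_star_quotient mult_star_proj add_star_proj
        smult_star_proj star_star_proj intro!: ring_hom_memI)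
qed

lemma star_proj_eq_zero_iff:
  assumes S: "S \<subseteq> carrier A" and x: "x \<in> carrier A"
  shows "star_proj A S x = \<zero>\<^bsub>star_quotient A S\<^esub> \<longleftrightarrow> x \<in> star_ideal A S"
proof -
  interpret I: ideal "star_ideal A S" A
    by (rule star_ideal_ideal[OF S])
  have "star_ideal A S +> x = star_ideal A S \<longleftrightarrow> x \<in> star_ideal A S"
    using x I.a_rcos_self[OF x] I.a_rcos_const by auto
  then show ?thesis
    by (simp add: star_quotient_def star_proj_def FactRing_simps)
qed

end

text \<open>The universal property of a quotient, for an arbitrary surjection \<open>p\<close>
  instead of a literal coset map, so that it also applies to a projection onto a twofold quotient.
  The factor \<open>k\<close> is \<open>h\<close> at a chosen preimage.\<close>

lemma star_hom_factor:
  assumes A: "star_algebra A" and B: "star_algebra B" and C: "star_algebra C"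
    and p: "p \<in> star_hom A B" and surj: "p ` carrier A = carrier B"
    and h: "h \<in> star_hom A C"
    and ker: "\<And>x. \<lbrakk>x \<in> carrier A; p x = \<zero>\<^bsub>B\<^esub>\<rbrakk> \<Longrightarrow> h x = \<zero>\<^bsub>C\<^esub>"
  obtains k where "k \<in> star_hom B C" and "\<And>x. x \<in> carrier A \<Longrightarrow> k (p x) = h x"
proof
  interpret A: star_algebra A by fact
  interpret B: star_algebra B by fact
  interpret C: star_algebra C by fact
  interpret p: ring_hom_ring A B p
    by (rule ring_hom_ringI2[OF A.ring_axioms B.ring_axioms star_homD(1)[OF p]])
  interpret h: ring_hom_ring A C h
    by (rule ring_hom_ringI2[OF A.ring_axioms C.ring_axioms star_homD(1)[OF h]])
  define k where "k y = h (inv_into (carrier A) p y)" for y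
  show k: "k (p x) = h x" if x: "x \<in> carrier A" for x
  proof -
    let ?y = "inv_into (carrier A) p (p x)"
    have y: "?y \<in> carrier A" "p ?y = p x"
      using x by (auto intro: inv_into_into f_inv_into_f)
    \<comment> \<open>Independence of the choice: two preimages of the same element differ by an
      element of the kernel of \<open>p\<close>, which \<open>h\<close> kills.\<close>
    have "p (?y \<ominus>\<^bsub>A\<^esub> x) = \<zero>\<^bsub>B\<^esub>"
      using x y by (simp add: A.minus_eq B.r_neg)
    then have "h ?y \<ominus>\<^bsub>C\<^esub> h x = \<zero>\<^bsub>C\<^esub>"
      using ker[of "?y \<ominus>\<^bsub>A\<^esub> x"] x y by (simp add: A.minus_eq C.minus_eq)
    then show ?thesis
      unfolding k_def using x y C.a_assoc[of "h ?y" "\<ominus>\<^bsub>C\<^esub> h x" "h x"]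
      by (simp add: C.minus_eq C.l_neg)
  qed
  have ex: "\<exists>x \<in> carrier A. y = p x" if "y \<in> carrier B" for y
    using that surj by auto
  show "k \<in> star_hom B C"
    unfolding star_hom_def
  proof (intro CollectI conjI allI ballI ring_hom_memI)
    fix y assume "y \<in> carrier B"
    then obtain x where x: "x \<in> carrier A" "y = p x" using ex by auto
    show "k y \<in> carrier C"
      using x by (simp add: k)
    show "k (c \<odot>\<^bsub>B\<^esub> y) = c \<odot>\<^bsub>C\<^esub> k y" for c
      using x k[of "c \<odot>\<^bsub>A\<^esub> x"] by (simp add: k A.smult_closed star_homD(2)[OF p] star_homD(2)[OF h])
    show "k (star B y) = star C (k y)"
      using x k[of "star A x"] by (simp add: k A.star_closed star_homD(3)[OF p] star_homD(3)[OF h])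
    fix y' assume "y' \<in> carrier B"
    then obtain x' where x': "x' \<in> carrier A" "y' = p x'" using ex by auto
    show "k (y \<otimes>\<^bsub>B\<^esub> y') = k y \<otimes>\<^bsub>C\<^esub> k y'"
      using x x' k[of "x \<otimes>\<^bsub>A\<^esub> x'"] by (simp add: k)
    show "k (y \<oplus>\<^bsub>B\<^esub> y') = k y \<oplus>\<^bsub>C\<^esub> k y'"
      using x x' k[of "x \<oplus>\<^bsub>A\<^esub> x'"] by (simp add: k)
  next
    show "k \<one>\<^bsub>B\<^esub> = \<one>\<^bsub>C\<^esub>"
      using k[of "\<one>\<^bsub>A\<^esub>"] by simp
  qed
qed

text \<open>The third isomorphism theorem on the level of kernels. Neither inclusion computes an
  ideal of the quotient. From left to right, the projection of \<open>A\<close> modulo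
  \<open>S \<union> R\<close> factors through \<open>B\<close> as a map \<open>k\<close> that kills
  the image of \<open>R\<close>; from right to left, the twofold projection kills both
  \<open>S\<close> and \<open>R\<close>.\<close>

lemma star_quotient_quotient_kernel:
  assumes A: "star_algebra A" and S: "S \<subseteq> carrier A" and R: "R \<subseteq> carrier A"
    and x: "x \<in> carrier A"
  defines "B \<equiv> star_quotient A S"
  shows "star_proj B (star_proj A S ` R) (star_proj A S x) = \<zero>\<^bsub>star_quotient B (star_proj A S ` R)\<^esub>
    \<longleftrightarrow> x \<in> star_ideal A (S \<union> R)"
proof -
  interpret A: star_algebra A by fact
  have SR: "S \<union> R \<subseteq> carrier A"
    using S R by simp
  let ?p = "star_proj A S" and ?h = "star_proj A (S \<union> R)"
  let ?C = "star_quotient A (S \<union> R)" and ?D = "star_quotient B (?p ` R)"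
  have B: "star_algebra B"
    unfolding B_def by (rule A.star_quotient_star_algebra[OF S])
  interpret B: star_algebra B by fact
  have C: "star_algebra ?C"
    by (rule A.star_quotient_star_algebra[OF SR])
  have p: "?p \<in> star_hom A B" and h: "?h \<in> star_hom A ?C"
    unfolding B_def by (rule A.star_proj_hom[OF S], rule A.star_proj_hom[OF SR])
  have surj: "?p ` carrier A = carrier B"
    by (simp add: B_def A.carrier_star_quotient)
  have pR: "?p ` R \<subseteq> carrier B"
    using R surj by auto
  have px: "?p x \<in> carrier B"
    using x surj by auto
  have D: "star_algebra ?D"
    by (rule B.star_quotient_star_algebra[OF pR])
  have gens: "?h y = \<zero>\<^bsub>?C\<^esub>" if "y \<in> S \<union> R" for y
    using that SR A.star_ideal_self[OF SR] by (subst A.star_proj_eq_zero_iff) auto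
  have "?h y = \<zero>\<^bsub>?C\<^esub>" if "y \<in> carrier A" "?p y = \<zero>\<^bsub>B\<^esub>" for y
    using that star_ideal_subset_kernel[OF A C h S, of y] gens
    by (auto simp: B_def A.star_proj_eq_zero_iff[OF S])
  then obtain k where k: "k \<in> star_hom B ?C" "\<And>y. y \<in> carrier A \<Longrightarrow> k (?p y) = ?h y"
    using star_hom_factor[OF A B C p surj h] by blast
  show ?thesis
  proof
    assume "star_proj B (?p ` R) (?p x) = \<zero>\<^bsub>?D\<^esub>"
    then have "?p x \<in> star_ideal B (?p ` R)"
      by (simp add: B.star_proj_eq_zero_iff[OF pR px])
    moreover have "k z = \<zero>\<^bsub>?C\<^esub>" if "z \<in> ?p ` R" for z
      using that gens R k(2) by blast
    ultimately have "k (?p x) = \<zero>\<^bsub>?C\<^esub>"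
      using star_ideal_subset_kernel[OF B C k(1) pR] by blast
    then show "x \<in> star_ideal A (S \<union> R)"
      using x k(2) by (simp add: A.star_proj_eq_zero_iff[OF SR])
  next
    assume x': "x \<in> star_ideal A (S \<union> R)"
    let ?g = "star_proj B (?p ` R) \<circ> ?p"
    have "?g y = \<zero>\<^bsub>?D\<^esub>" if y: "y \<in> S \<union> R" for y
    proof -
      interpret J: ideal "star_ideal B (?p ` R)" B
        by (rule B.star_ideal_ideal[OF pR])
      have "?p y \<in> star_ideal B (?p ` R)"
      proof (cases "y \<in> S")
        case True
        then have "?p y = \<zero>\<^bsub>B\<^esub>"
          unfolding B_def using S A.star_ideal_self[OF S] by (subst A.star_proj_eq_zero_iff) auto
        then show ?thesis by simp
      next
        case False
        with y show ?thesis using B.star_ideal_self[OF pR] by auto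
      qed
      moreover have "?p y \<in> carrier B" using y SR surj by auto
      ultimately show ?thesis by (simp add: B.star_proj_eq_zero_iff[OF pR])
    qed
    then have "?g x = \<zero>\<^bsub>?D\<^esub>"
      using star_ideal_subset_kernel[OF A D star_hom_comp[OF p B.star_proj_hom[OF pR]] SR _ x']
      by blast
    then show "star_proj B (?p ` R) (?p x) = \<zero>\<^bsub>?D\<^esub>" by simp
  qed
qed

section \<open>Substitution in free algebras\<close>

fun letter_subst :: "('g \<Rightarrow> 'k free_algebra) \<Rightarrow> 'g letter \<Rightarrow> 'k free_algebra" where
  "letter_subst f (Gen g) = f g"
| "letter_subst f (Gen_star g) = adj (f g)"

definition word_subst :: "('g \<Rightarrow> 'k free_algebra) \<Rightarrow> 'g word \<Rightarrow> 'k free_algebra" where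
  "word_subst f w = prod_list (map (letter_subst f) (letters w))"

text \<open>This is the unital *-homomorphism of free *-algebras that extends \<open>f\<close>, i.e.
  their universal property.\<close>

definition subst :: "('g \<Rightarrow> 'k free_algebra) \<Rightarrow> 'g free_algebra \<Rightarrow> 'k free_algebra" where
  "subst f p = (\<Sum>w\<in>Poly_Mapping.keys p. scal (Poly_Mapping.lookup p w) * word_subst f w)"

lemma scal_zero [simp]: "scal 0 = 0"
  by (simp add: scal_def)

lemma scal_minus: "scal (- c) = - scal c"
  by (simp add: scal_def single_uminus)

lemma scal_diff: "scal (c - d) = scal c - scal d"
  by (simp add: scal_def single_diff)

lemma adj_minus: "adj (- p) = - adj p"
  by (rule poly_mapping_eqI) (simp add: lookup_adj)

lemma adj_diff: "adj (p - r) = adj p - adj r"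
  by (rule poly_mapping_eqI) (simp add: lookup_adj lookup_minus)

lemma adj_one [simp]: "adj 1 = 1"
  using adj_scal[of 1] by simp

lemma word_subst_zero [simp]: "word_subst f 0 = 1"
  by (simp add: word_subst_def zero_word_def)

lemma word_subst_plus: "word_subst f (v + w) = word_subst f v * word_subst f w"
  by (simp add: word_subst_def plus_word_def)

lemma word_subst_star: "word_subst f (word_star w) = adj (word_subst f w)"
proof -
  have "letter_subst f (letter_star l) = adj (letter_subst f l)" for l
    by (cases l) simp_all
  then have "prod_list (map (letter_subst f) (rev (map letter_star ls))) =
      adj (prod_list (map (letter_subst f) ls))" for ls
    by (induction ls) (simp_all add: adj_mult)
  then show ?thesis
    by (simp add: word_subst_def word_star_def)
qed

lemma subst_zero [simp]: "subst f 0 = 0"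
  by (simp add: subst_def)

lemma subst_single: "subst f (Poly_Mapping.single w c) = scal c * word_subst f w"
  by (simp add: subst_def)

lemma subst_add: "subst f (p + r) = subst f p + subst f r"
  unfolding subst_def by (rule setsum_keys_plus_distrib) (simp_all add: scal_add distrib_right)

lemma subst_mult: "subst f (p * r) = subst f p * subst f r"
proof (induction p rule: free_algebra_induct)
  case zero
  show ?case by simp
next
  case (add p w c)
  have "subst f (Poly_Mapping.single w c * r) = subst f (Poly_Mapping.single w c) * subst f r"
  proof (induction r rule: free_algebra_induct)
    case zero
    show ?case by simp
  next
    case (add r v d)
    have "word_subst f w * (scal d * word_subst f v) = scal d * (word_subst f w * word_subst f v)"
      using scal_commute[of "word_subst f w" d] by (simp flip: mult.assoc)
    then show ?case
      using add by (simp add: distrib_left subst_add subst_single mult_single scal_mult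
          word_subst_plus mult.assoc)
  qed
  with add show ?case
    by (simp add: distrib_right subst_add)
qed

lemma subst_adj: "subst f (adj p) = adj (subst f p)"
  by (induction p rule: free_algebra_induct)
    (simp_all add: adj_add subst_add adj_single subst_single word_subst_star adj_mult adj_scal
      scal_commute[of "adj _"])

lemma subst_scal [simp]: "subst f (scal c) = scal c"
  by (simp add: scal_def subst_single[unfolded scal_def])

lemma subst_one [simp]: "subst f 1 = 1"
  using subst_scal[of f 1] by simp

lemma subst_minus: "subst f (- p) = - subst f p"
  using subst_add[of f p "- p"] by (simp add: eq_neg_iff_add_eq_0 add.commute)

lemma subst_diff: "subst f (p - r) = subst f p - subst f r"
  using subst_add[of f p "- r"] by (simp add: subst_minus)

lemma subst_gen [simp]: "subst f (gen g) = f g"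
  by (simp add: gen_def subst_single word_subst_def)

lemma free_star_algebra_simps [simp]:
  "carrier free_star_algebra = UNIV"
  "p \<otimes>\<^bsub>free_star_algebra\<^esub> r = p * r"
  "p \<oplus>\<^bsub>free_star_algebra\<^esub> r = p + r"
  "\<one>\<^bsub>free_star_algebra\<^esub> = 1"
  "\<zero>\<^bsub>free_star_algebra\<^esub> = 0"
  "c \<odot>\<^bsub>free_star_algebra\<^esub> p = scal c * p"
  "star free_star_algebra p = adj p"
  by (simp_all add: free_star_algebra_def)

lemma subst_hom: "subst f \<in> star_hom free_star_algebra free_star_algebra"
  by (auto simp: star_hom_def subst_add subst_mult subst_adj intro!: ring_hom_memI)

section \<open>Presentations\<close>

abbreviation free_ideal :: "'g free_algebra set \<Rightarrow> 'g free_algebra set" where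
  "free_ideal \<equiv> star_ideal free_star_algebra"

lemma
  shows free_ideal_zero: "0 \<in> free_ideal S"
    and free_ideal_add: "\<lbrakk>p \<in> free_ideal S; r \<in> free_ideal S\<rbrakk> \<Longrightarrow> p + r \<in> free_ideal S"
    and free_ideal_mult_left: "p \<in> free_ideal S \<Longrightarrow> r * p \<in> free_ideal S"
    and free_ideal_mult_right: "p \<in> free_ideal S \<Longrightarrow> p * r \<in> free_ideal S"
    and free_ideal_adj: "p \<in> free_ideal S \<Longrightarrow> adj p \<in> free_ideal S"
    and free_ideal_gen: "p \<in> S \<Longrightarrow> p \<in> free_ideal S"
proof -
  interpret F: star_algebra free_star_algebra
    by (rule free_star_algebra)
  interpret I: ideal "free_ideal S" free_star_algebra
    by (rule F.star_ideal_ideal) simp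
  show "0 \<in> free_ideal S"
    using I.zero_closed by simp
  show "p + r \<in> free_ideal S" if "p \<in> free_ideal S" "r \<in> free_ideal S"
    using I.a_closed[OF that] by simp
  show "r * p \<in> free_ideal S" if "p \<in> free_ideal S"
    using I.I_l_closed[OF that, of r] by simp
  show "p * r \<in> free_ideal S" if "p \<in> free_ideal S"
    using I.I_r_closed[OF that, of r] by simp
  show "adj p \<in> free_ideal S" if "p \<in> free_ideal S"
    using F.star_ideal_star[OF _ that] by simp
  show "p \<in> free_ideal S" if "p \<in> S"
    using F.star_ideal_self[of S] that by auto
qed

lemma free_ideal_minus: "p \<in> free_ideal S \<Longrightarrow> - p \<in> free_ideal S"
  using free_ideal_mult_left[of p S "- 1"] by simp

lemma free_ideal_diff: "\<lbrakk>p \<in> free_ideal S; r \<in> free_ideal S\<rbrakk> \<Longrightarrow> p - r \<in> free_ideal S"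
  using free_ideal_add[of p S "- r"] free_ideal_minus[of r S] by simp

text \<open>A presentation is recorded as a surjection from the free algebra with the right kernel,
  not as an equality with a particular coset construction. The elements of \<open>A\<close> may then
  be of any type, in particular cosets of cosets.\<close>

definition presents ::
    "('a, 'c) star_algebra_scheme \<Rightarrow> 'g free_algebra set \<Rightarrow> ('g free_algebra \<Rightarrow> 'a) \<Rightarrow> bool" where
  "presents A S \<pi> \<longleftrightarrow> star_algebra A \<and> \<pi> \<in> star_hom free_star_algebra A \<and>
     range \<pi> = carrier A \<and> (\<forall>p. \<pi> p = \<zero>\<^bsub>A\<^esub> \<longleftrightarrow> p \<in> free_ideal S)"

lemma presents_presented:
  "presents (presented_star_algebra S) S (star_proj free_star_algebra S)"
proof -
  interpret F: star_algebra free_star_algebra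
    by (rule free_star_algebra)
  show ?thesis
    unfolding presents_def presented_star_algebra_def
    using F.star_quotient_star_algebra[of S] F.star_proj_hom[of S]
      F.star_proj_eq_zero_iff[of S] F.carrier_star_quotient[of S] by simp
qed

text \<open>The last claim is the bridge of the whole proof: equations in a presented algebra become
  membership of a difference in an ideal of the free algebra.\<close>

lemma
  assumes "presents A S \<pi>"
  shows presents_add: "\<pi> (p + r) = \<pi> p \<oplus>\<^bsub>A\<^esub> \<pi> r"
    and presents_diff: "\<pi> (p - r) = \<pi> p \<ominus>\<^bsub>A\<^esub> \<pi> r"
    and presents_one: "\<pi> 1 = \<one>\<^bsub>A\<^esub>"
    and presents_zero: "\<pi> 0 = \<zero>\<^bsub>A\<^esub>"
    and presents_scal: "\<pi> (scal c * p) = c \<odot>\<^bsub>A\<^esub> \<pi> p"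
    and presents_eq_iff: "\<pi> p = \<pi> r \<longleftrightarrow> p - r \<in> free_ideal S"
proof -
  have \<pi>: "star_algebra A" "\<pi> \<in> star_hom free_star_algebra A" "range \<pi> = carrier A"
    "\<And>p. \<pi> p = \<zero>\<^bsub>A\<^esub> \<longleftrightarrow> p \<in> free_ideal S"
    using assms by (auto simp: presents_def)
  interpret A: star_algebra A by fact
  have c: "\<pi> p \<in> carrier A" for p
    using \<pi>(3) by auto
  show add: "\<pi> (p + r) = \<pi> p \<oplus>\<^bsub>A\<^esub> \<pi> r" for p r
    using ring_hom_add[OF star_homD(1)[OF \<pi>(2)], of p r] by simp
  show one: "\<pi> 1 = \<one>\<^bsub>A\<^esub>"
    using ring_hom_one[OF star_homD(1)[OF \<pi>(2)]] by simp
  show zero: "\<pi> 0 = \<zero>\<^bsub>A\<^esub>"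
    using free_ideal_zero by (simp add: \<pi>(4))
  show "\<pi> (scal c * p) = c \<odot>\<^bsub>A\<^esub> \<pi> p"
    using star_homD(2)[OF \<pi>(2), of p c] by simp
  show diff: "\<pi> (p - r) = \<pi> p \<ominus>\<^bsub>A\<^esub> \<pi> r" for p r
  proof -
    have "\<pi> p = \<pi> (p - r) \<oplus>\<^bsub>A\<^esub> \<pi> r"
      using add[of "p - r" r] by simp
    then show ?thesis
      using c[of r] c[of "p - r"] by (simp add: A.minus_eq A.a_assoc A.r_neg)
  qed
  have "\<pi> p = \<pi> r \<longleftrightarrow> \<pi> (p - r) = \<zero>\<^bsub>A\<^esub>"
  proof
    assume "\<pi> (p - r) = \<zero>\<^bsub>A\<^esub>"
    then show "\<pi> p = \<pi> r"
      using add[of "p - r" r] c[of r] by simp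
  qed (use c in \<open>simp add: diff A.minus_eq A.r_neg\<close>)
  then show "\<pi> p = \<pi> r \<longleftrightarrow> p - r \<in> free_ideal S"
    by (simp add: \<pi>(4))
qed

text \<open>The substitution followed by the projection modulo \<open>R\<close> is a *-homomorphism
  that kills \<open>S\<close>, hence the *-ideal of \<open>S\<close>.\<close>

lemma subst_free_ideal:
  assumes "\<And>r. r \<in> S \<Longrightarrow> subst f r \<in> free_ideal R" and "p \<in> free_ideal S"
  shows "subst f p \<in> free_ideal R"
proof -
  let ?B = "presented_star_algebra R" and ?\<rho> = "star_proj free_star_algebra R"
  have B: "star_algebra ?B" and \<rho>: "?\<rho> \<in> star_hom free_star_algebra ?B"
    and ker: "\<And>p. ?\<rho> p = \<zero>\<^bsub>?B\<^esub> \<longleftrightarrow> p \<in> free_ideal R"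
    using presents_presented[of R] by (auto simp: presents_def)
  have "(?\<rho> \<circ> subst f) p = \<zero>\<^bsub>?B\<^esub>"
    using star_ideal_subset_kernel[OF free_star_algebra B star_hom_comp[OF subst_hom \<rho>], of S f p]
      assms ker by simp
  then show ?thesis by (simp add: ker)
qed

text \<open>Congruence modulo a *-ideal respects sums, products and adjoints, so a composite that
  fixes the generators up to the ideal fixes every polynomial up to the ideal.\<close>

lemma subst_subst_congruent:
  assumes "\<And>x. subst g (f x) - gen x \<in> free_ideal S"
  shows "subst g (subst f p) - p \<in> free_ideal S"
proof -
  have mult: "p' * r' - p * r \<in> free_ideal S"
    if "p' - p \<in> free_ideal S" "r' - r \<in> free_ideal S" for p p' r r'
  proof -
    have "p' * r' - p * r = (p' - p) * r' + p * (r' - r)"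
      by (simp add: algebra_simps)
    then show ?thesis
      using that by (simp add: free_ideal_add free_ideal_mult_left free_ideal_mult_right)
  qed
  have letter: "subst g (letter_subst f l) - Poly_Mapping.single (Word [l]) 1 \<in> free_ideal S" for l
  proof (cases l)
    case (Gen x)
    then show ?thesis using assms[of x] by (simp add: gen_def)
  next
    case (Gen_star x)
    then show ?thesis
      using free_ideal_adj[OF assms[of x]]
      by (simp add: gen_def adj_diff adj_single word_star_def subst_adj)
  qed
  have word: "subst g (word_subst f w) - Poly_Mapping.single w 1 \<in> free_ideal S" for w
  proof -
    have "subst g (word_subst f (Word ls)) - Poly_Mapping.single (Word ls) 1 \<in> free_ideal S" for ls
    proof (induction ls)
      case Nil
      have "Poly_Mapping.single (Word []) 1 = (1 :: 'a free_algebra)"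
        by (simp flip: zero_word_def)
      then show ?case
        by (simp add: word_subst_def free_ideal_zero)
    next
      case (Cons l ls)
      have "Poly_Mapping.single (Word (l # ls)) (1 :: complex) =
          Poly_Mapping.single (Word [l]) 1 * Poly_Mapping.single (Word ls) 1"
        by (simp add: mult_single plus_word_def)
      moreover have "subst g (word_subst f (Word (l # ls))) =
          subst g (letter_subst f l) * subst g (word_subst f (Word ls))"
        by (simp add: word_subst_def subst_mult)
      ultimately show ?case
        using mult[OF letter[of l] Cons.IH] by simp
    qed
    then show ?thesis by (cases w) simp
  qed
  show ?thesis
  proof (induction p rule: free_algebra_induct)
    case zero
    show ?case by (simp add: free_ideal_zero)
  next
    case (add p w c)
    have "Poly_Mapping.single w c = scal c * Poly_Mapping.single w 1"
      by (simp add: scal_def mult_single)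
    then have eq: "subst g (subst f (Poly_Mapping.single w c + p)) - (Poly_Mapping.single w c + p) =
        scal c * (subst g (word_subst f w) - Poly_Mapping.single w 1) + (subst g (subst f p) - p)"
      by (simp add: subst_add subst_mult subst_single algebra_simps)
    show ?case
      unfolding eq by (intro free_ideal_add free_ideal_mult_left word add)
  qed
qed

text \<open>Condition \<open>f\<close> makes the induced map well defined, \<open>g\<close> and
  \<open>gf\<close> make it injective, and \<open>fg\<close> supplies preimages.\<close>

lemma presents_iso:
  assumes A: "presents A S \<pi>" and B: "presents B R \<rho>"
    and f: "\<And>r. r \<in> S \<Longrightarrow> subst f r \<in> free_ideal R"
    and g: "\<And>r. r \<in> R \<Longrightarrow> subst g r \<in> free_ideal S"
    and gf: "\<And>x. subst g (f x) - gen x \<in> free_ideal S"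
    and fg: "\<And>y. subst f (g y) - gen y \<in> free_ideal R"
  obtains \<phi> where "\<phi> \<in> star_algebra_iso A B" and "\<And>p. \<phi> (\<pi> p) = \<rho> (subst f p)"
proof -
  have \<pi>: "star_algebra A" "\<pi> \<in> star_hom free_star_algebra A" "range \<pi> = carrier A"
    "\<And>p. \<pi> p = \<zero>\<^bsub>A\<^esub> \<longleftrightarrow> p \<in> free_ideal S"
    using A by (auto simp: presents_def)
  have \<rho>: "star_algebra B" "\<rho> \<in> star_hom free_star_algebra B" "range \<rho> = carrier B"
    "\<And>p. \<rho> p = \<zero>\<^bsub>B\<^esub> \<longleftrightarrow> p \<in> free_ideal R"
    using B by (auto simp: presents_def)
  have "(\<rho> \<circ> subst f) p = \<zero>\<^bsub>B\<^esub>" if "\<pi> p = \<zero>\<^bsub>A\<^esub>" for p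
    using that subst_free_ideal[of S f R, OF f] by (simp add: \<pi>(4) \<rho>(4))
  then obtain \<phi> where \<phi>: "\<phi> \<in> star_hom A B" "\<And>p. \<phi> (\<pi> p) = \<rho> (subst f p)"
    using star_hom_factor[OF free_star_algebra \<pi>(1) \<rho>(1) \<pi>(2) _ star_hom_comp[OF subst_hom \<rho>(2)],
        of f] \<pi>(3) by (metis UNIV_I comp_apply free_star_algebra_simps(1))
  have "inj_on \<phi> (carrier A)"
  proof (rule inj_onI)
    fix x y assume "x \<in> carrier A" "y \<in> carrier A" and eq: "\<phi> x = \<phi> y"
    then obtain p r where pr: "x = \<pi> p" "y = \<pi> r"
      using \<pi>(3) by blast
    then have "subst f (p - r) \<in> free_ideal R"
      using eq by (simp add: \<phi>(2) presents_eq_iff[OF B] subst_diff)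
    then have "subst g (subst f (p - r)) \<in> free_ideal S"
      using subst_free_ideal[of R g S, OF g] by blast
    \<comment> \<open>Write \<open>p - r\<close> as its image under both substitutions minus the
      error of that round trip; both terms lie in the ideal.\<close>
    then have "p - r \<in> free_ideal S"
      using free_ideal_diff[OF _ subst_subst_congruent[of g f S "p - r", OF gf]] by fastforce
    then show "x = y"
      by (simp add: pr presents_eq_iff[OF A])
  qed
  moreover have "\<phi> ` carrier A = carrier B"
  proof -
    have "\<rho> p = \<phi> (\<pi> (subst g p))" for p
      using subst_subst_congruent[of f g R p, OF fg]
      by (simp add: \<phi>(2) presents_eq_iff[OF B] flip: presents_eq_iff[OF B])
    then have "range \<rho> \<subseteq> \<phi> ` range \<pi>" by auto
    moreover have "\<phi> ` range \<pi> \<subseteq> range \<rho>" by (auto simp: \<phi>(2))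
    ultimately show ?thesis using \<pi>(3) \<rho>(3) by auto
  qed
  ultimately have "\<phi> \<in> star_algebra_iso A B"
    by (simp add: star_algebra_iso_iff \<phi>(1) bij_betw_def)
  with \<phi>(2) show ?thesis using that by blast
qed

section \<open>Normal forms of polynomials in noncommuting letters\<close>

lemma gen_scal:
  "gen g * scal c = scal c * gen g" "gen g * (scal c * p) = scal c * (gen g * p)"
  "adj (gen g) * scal c = scal c * adj (gen g)" "adj (gen g) * (scal c * p) = scal c * (adj (gen g) * p)"
  by (simp_all add: scal_commute[of "gen g"] scal_commute[of "adj (gen g)"] flip: mult.assoc)

lemma scal_scal: "scal c * scal d = scal (c * d)" "scal c * (scal d * p) = scal (c * d) * p"
  by (simp_all add: scal_mult mult.assoc)

lemmas subst_simps = subst_add subst_diff subst_minus subst_mult subst_adj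
  adj_add adj_diff adj_minus adj_mult adj_scal

text \<open>Together with \<open>algebra_simps\<close> these drive scalars to the front of each
  monomial and merge them. Only the complex coefficients are reordered, never the letters, so
  identities in the free algebra reduce to comparing coefficients.\<close>

lemmas scal_simps = gen_scal scal_scal scal_add scal_diff scal_minus

section \<open>The Podles sphere and the time slice\<close>

text \<open>A representative in the free algebra of the single element of \<open>slice_rels\<close>.
  The factor \<open>1\<close> gives the constant term the shape to which
  \<open>presents_scal\<close> applies.\<close>

definition slice_rel :: "real \<Rightarrow> real \<Rightarrow> hyp_gen free_algebra" where
  "slice_rel q t = scal (inverse q) * gen Hyp_alpha + scal q * gen Hyp_delta - scal (t + inverse t) * 1"

fun podles_to_slice :: "real \<Rightarrow> real \<Rightarrow> podles_gen \<Rightarrow> hyp_gen free_algebra" where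
  "podles_to_slice q t Pod_x = scal (t * inverse q) * gen Hyp_alpha"
| "podles_to_slice q t Pod_z = scal (q * t) * gen Hyp_beta"

text \<open>The value at \<open>Hyp_delta\<close> is obtained by solving the slice relation for
  \<delta> and inserting the value of \<alpha>.\<close>

fun slice_to_podles :: "real \<Rightarrow> real \<Rightarrow> hyp_gen \<Rightarrow> podles_gen free_algebra" where
  "slice_to_podles q t Hyp_alpha = scal (q * inverse t) * gen Pod_x"
| "slice_to_podles q t Hyp_beta = scal (inverse q * inverse t) * gen Pod_z"
| "slice_to_podles q t Hyp_delta =
    scal (inverse q * (t + inverse t)) - scal (inverse q * inverse t) * gen Pod_x"

lemmas free_ideal_closed = free_ideal_add free_ideal_diff free_ideal_minus
  free_ideal_mult_left free_ideal_mult_right free_ideal_adj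

text \<open>
  Below \<open>b\<close> and \<open>d\<close> are the inverses of \<open>a\<close> and \<open>c\<close>. The names are chosen so that, in the
  simplifier's term order, inverse scalars become adjacent and cancel.
\<close>

lemma podles_to_slice_rels:
  assumes "q \<noteq> 0" and "t \<noteq> 0" and r: "r \<in> podles_rels (q\<^sup>2) (- (t\<^sup>2))"
  shows "subst (podles_to_slice q t) r \<in> free_ideal (hyp_rels q \<union> {slice_rel q t})"
proof -
  define a b c d where "a = complex_of_real q" and "b = complex_of_real (inverse q)"
    and "c = complex_of_real t" and "d = complex_of_real (inverse t)"
  note defs = this
  have inv: "a * b = 1" "a * (b * x) = x" "c * d = 1" "c * (d * x) = x" for x
    using assms(1,2) by (simp_all add: defs)
  have real: "cnj a = a" "cnj b = b" "cnj c = c" "cnj d = d"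
    by (simp_all add: defs)
  let ?I = "free_ideal (hyp_rels q \<union> {slice_rel q t})"
  let ?f = "subst (podles_to_slice q t)"
  define \<alpha> \<beta> \<delta> where "\<alpha> = gen Hyp_alpha" and "\<beta> = gen Hyp_beta" and "\<delta> = gen Hyp_delta"
  note gens = this
  define x z where "x = gen Pod_x" and "z = gen Pod_z"
  note gens' = this
  define s where "s = scal b * \<alpha> + scal a * \<delta> - (scal c + scal d)"
  define h1 where "h1 = \<alpha> - adj \<alpha>"
  define h3 where "h3 = \<beta> * \<alpha> - scal (a * a) * \<alpha> * \<beta>"
  define h5 where "h5 = (\<beta> * adj \<beta> - adj \<beta> * \<beta>) - scal (1 - b * b) * \<alpha> * (\<delta> - \<alpha>)"
  define h7 where "h7 = (\<alpha> * \<delta> - scal (a * a) * adj \<beta> * \<beta>) - 1"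
  note rels = h1_def h3_def h5_def h7_def s_def
  have I: "h1 \<in> ?I" "h3 \<in> ?I" "h5 \<in> ?I" "h7 \<in> ?I" "s \<in> ?I"
    by (rule free_ideal_gen, simp add: hyp_rels_def slice_rel_def rels gens defs Let_def
        power2_eq_square scal_add divide_inverse)+
  have f: "?f x = scal (c * b) * \<alpha>" "?f z = scal (a * c) * \<beta>"
    by (simp_all add: gens gens' defs)
  note norm = f subst_simps rels algebra_simps gens scal_simps inv real
  have "?f (x - adj x) = scal (c * b) * h1"
    by (simp add: norm)
  also have "\<dots> \<in> ?I"
    by (intro free_ideal_closed I)
  finally have 1: "?f (x - adj x) \<in> ?I" .
  have "?f (z * x - scal (a * a) * x * z) = scal (c * c) * h3"
    by (simp add: norm)
  also have "\<dots> \<in> ?I"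
    by (intro free_ideal_closed I)
  finally have 2: "?f (z * x - scal (a * a) * x * z) \<in> ?I" .
  \<comment> \<open>The cofactors are successive eliminations: \<open>h5\<close> trades
    \<open>\<beta> * adj \<beta>\<close> for \<open>adj \<beta> * \<beta>\<close>, \<open>h7\<close>
    trades the latter for \<alpha>\<delta> - 1, and \<open>s\<close> removes the remaining \<delta>.
    For \<open>adj z * z\<close> below, the elimination starts at \<open>h7\<close>.\<close>
  have "?f (z * adj z - (scal (- (c * c)) + scal (a * a) * x) * (1 - scal (a * a) * x)) =
      scal (a * a * c * c) * h5 - scal (c * c) * h7 + scal (a * c * c) * \<alpha> * s"
    by (simp add: norm)
  also have "\<dots> \<in> ?I"
    by (intro free_ideal_closed I)
  finally have 3: "?f (z * adj z -
      (scal (- (c * c)) + scal (a * a) * x) * (1 - scal (a * a) * x)) \<in> ?I" .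
  have "?f (adj z * z - (scal (- (c * c)) + x) * (1 - x)) =
      scal (c * c * b) * \<alpha> * s - scal (c * c) * h7"
    by (simp add: norm)
  also have "\<dots> \<in> ?I"
    by (intro free_ideal_closed I)
  finally have 4: "?f (adj z * z - (scal (- (c * c)) + x) * (1 - x)) \<in> ?I" .
  have "podles_rels (q\<^sup>2) (- (t\<^sup>2)) = {x - adj x, z * x - scal (a * a) * x * z,
      z * adj z - (scal (- (c * c)) + scal (a * a) * x) * (1 - scal (a * a) * x),
      adj z * z - (scal (- (c * c)) + x) * (1 - x)}"
    by (simp add: podles_rels_def Let_def gens' defs power2_eq_square)
  from r[unfolded this] show ?thesis
    using 1 2 3 4 by (elim insertE emptyE) (simp_all only:)
qed

text \<open>The image of \<delta> is affine in \<open>x\<close> and solves the slice relation, so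
  that relation and the commutator of \<delta> with \<alpha> vanish identically, while the relation
  for the commutator of \<delta> with \<beta> collapses to a multiple of \<open>r2\<close>. The
  determinant relation is \<open>r4\<close> rescaled, and the commutator of \<beta> with its adjoint
  compares the two factorizations, hence \<open>r3 - r4\<close>.\<close>

lemma slice_to_podles_rels:
  assumes "q \<noteq> 0" and "t \<noteq> 0" and r: "r \<in> hyp_rels q \<union> {slice_rel q t}"
  shows "subst (slice_to_podles q t) r \<in> free_ideal (podles_rels (q\<^sup>2) (- (t\<^sup>2)))"
proof -
  define a b c d where "a = complex_of_real q" and "b = complex_of_real (inverse q)"
    and "c = complex_of_real t" and "d = complex_of_real (inverse t)"
  note defs = this
  have inv: "a * b = 1" "a * (b * x) = x" "c * d = 1" "c * (d * x) = x" for x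
    using assms(1,2) by (simp_all add: defs)
  have real: "cnj a = a" "cnj b = b" "cnj c = c" "cnj d = d"
    by (simp_all add: defs)
  let ?I = "free_ideal (podles_rels (q\<^sup>2) (- (t\<^sup>2)))"
  let ?g = "subst (slice_to_podles q t)"
  define \<alpha> \<beta> \<delta> where "\<alpha> = gen Hyp_alpha" and "\<beta> = gen Hyp_beta" and "\<delta> = gen Hyp_delta"
  note gens' = this
  define x z where "x = gen Pod_x" and "z = gen Pod_z"
  note gens = this
  define r1 where "r1 = x - adj x"
  define r2 where "r2 = z * x - scal (a * a) * x * z"
  define r3 where "r3 = z * adj z - (scal (- (c * c)) + scal (a * a) * x) * (1 - scal (a * a) * x)"
  define r4 where "r4 = adj z * z - (scal (- (c * c)) + x) * (1 - x)"
  note rels = r1_def r2_def r3_def r4_def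
  have I: "r1 \<in> ?I" "r2 \<in> ?I" "r3 \<in> ?I" "r4 \<in> ?I"
    by (rule free_ideal_gen, simp add: podles_rels_def rels gens defs Let_def power2_eq_square)+
  have g: "?g \<alpha> = scal (a * d) * x" "?g \<beta> = scal (b * d) * z"
      "?g \<delta> = scal (b * (c + d)) - scal (b * d) * x"
    by (simp_all add: gens gens' defs)
  note norm = g subst_simps rels algebra_simps gens scal_simps inv real
  have "?g (\<alpha> - adj \<alpha>) = scal (a * d) * r1"
    by (simp add: norm)
  also have "\<dots> \<in> ?I"
    by (intro free_ideal_closed I)
  finally have 1: "?g (\<alpha> - adj \<alpha>) \<in> ?I" .
  have "?g (\<delta> - adj \<delta>) = scal (- (b * d)) * r1"
    by (simp add: norm)
  also have "\<dots> \<in> ?I"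
    by (intro free_ideal_closed I)
  finally have 2: "?g (\<delta> - adj \<delta>) \<in> ?I" .
  have "?g (\<beta> * \<alpha> - scal (a * a) * \<alpha> * \<beta>) = scal (d * d) * r2"
    by (simp add: norm)
  also have "\<dots> \<in> ?I"
    by (intro free_ideal_closed I)
  finally have 3: "?g (\<beta> * \<alpha> - scal (a * a) * \<alpha> * \<beta>) \<in> ?I" .
  have "?g (\<delta> * \<alpha> - \<alpha> * \<delta>) = 0"
    by (simp add: norm)
  also have "\<dots> \<in> ?I"
    by (rule free_ideal_zero)
  finally have 4: "?g (\<delta> * \<alpha> - \<alpha> * \<delta>) \<in> ?I" .
  have "?g ((\<beta> * adj \<beta> - adj \<beta> * \<beta>) - scal (1 - b * b) * \<alpha> * (\<delta> - \<alpha>)) =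
      scal (b * b * d * d) * (r3 - r4)"
    by (simp add: norm)
  also have "\<dots> \<in> ?I"
    by (intro free_ideal_closed I)
  finally have 5: "?g ((\<beta> * adj \<beta> - adj \<beta> * \<beta>) - scal (1 - b * b) * \<alpha> * (\<delta> - \<alpha>)) \<in> ?I" .
  have "?g ((\<delta> * \<beta> - \<beta> * \<delta>) - scal (1 - b * b) * \<alpha> * \<beta>) = scal (b * b * d * d) * r2"
    by (simp add: norm)
  also have "\<dots> \<in> ?I"
    by (intro free_ideal_closed I)
  finally have 6: "?g ((\<delta> * \<beta> - \<beta> * \<delta>) - scal (1 - b * b) * \<alpha> * \<beta>) \<in> ?I" .
  have "?g ((\<alpha> * \<delta> - scal (a * a) * adj \<beta> * \<beta>) - 1) = scal (- (d * d)) * r4"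
    by (simp add: norm)
  also have "\<dots> \<in> ?I"
    by (intro free_ideal_closed I)
  finally have 7: "?g ((\<alpha> * \<delta> - scal (a * a) * adj \<beta> * \<beta>) - 1) \<in> ?I" .
  have "?g (scal b * \<alpha> + scal a * \<delta> - scal (c + d)) = 0"
    by (simp add: norm)
  also have "\<dots> \<in> ?I"
    by (rule free_ideal_zero)
  finally have 8: "?g (scal b * \<alpha> + scal a * \<delta> - scal (c + d)) \<in> ?I" .
  have "hyp_rels q \<union> {slice_rel q t} =
      {\<alpha> - adj \<alpha>, \<delta> - adj \<delta>, \<beta> * \<alpha> - scal (a * a) * \<alpha> * \<beta>, \<delta> * \<alpha> - \<alpha> * \<delta>,
       (\<beta> * adj \<beta> - adj \<beta> * \<beta>) - scal (1 - b * b) * \<alpha> * (\<delta> - \<alpha>),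
       (\<delta> * \<beta> - \<beta> * \<delta>) - scal (1 - b * b) * \<alpha> * \<beta>,
       (\<alpha> * \<delta> - scal (a * a) * adj \<beta> * \<beta>) - 1,
       scal b * \<alpha> + scal a * \<delta> - scal (c + d)}"
    by (auto simp: hyp_rels_def slice_rel_def Let_def gens' defs power2_eq_square divide_inverse)
  from r[unfolded this] show ?thesis
    using 1 2 3 4 5 6 7 8 by (elim insertE emptyE) (simp_all only:)
qed

text \<open>\<alpha> and \<beta> return exactly. \<delta> returns as the expression solved from the
  slice relation, so it is recovered only modulo that relation.\<close>

lemma slice_to_podles_to_slice:
  assumes "q \<noteq> 0" and "t \<noteq> 0"
  shows "subst (podles_to_slice q t) (slice_to_podles q t y) - gen y
    \<in> free_ideal (hyp_rels q \<union> {slice_rel q t})"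
proof (cases y)
  case Hyp_delta
  let ?I = "free_ideal (hyp_rels q \<union> {slice_rel q t})"
  have "subst (podles_to_slice q t) (slice_to_podles q t Hyp_delta) - gen Hyp_delta =
      scal (- inverse q) * slice_rel q t"
    using assms by (simp add: slice_rel_def subst_simps scal_simps field_simps)
  also have "\<dots> \<in> ?I"
    by (intro free_ideal_mult_left free_ideal_gen) simp
  finally show ?thesis
    by (simp only: Hyp_delta)
qed (use assms in \<open>simp_all add: subst_simps scal_simps field_simps free_ideal_zero\<close>)

lemma podles_to_slice_to_podles:
  assumes "q \<noteq> 0" and "t \<noteq> 0"
  shows "subst (slice_to_podles q t) (podles_to_slice q t x) = gen x"
  using assms by (cases x) (simp_all add: subst_simps scal_simps field_simps)

section \<open>The q-fuzzy sphere\<close>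

text \<open>The affine map moves the roots t^2 and 1 of \<open>adj z * z\<close> to the roots 0 and
  1 of \<open>adj b * b\<close>; it exists because t^2 \<noteq> 1 keeps the roots apart. The minus
  sign in \<open>Fuz_b\<close> is dictated by the off-diagonal entries of 1 - q t u.\<close>

fun fuzzy_to_podles :: "real \<Rightarrow> fuzzy_gen \<Rightarrow> podles_gen free_algebra" where
  "fuzzy_to_podles t Fuz_a = scal (1 / (1 - t\<^sup>2)) * gen Pod_x - scal (t\<^sup>2 / (1 - t\<^sup>2))"
| "fuzzy_to_podles t Fuz_b = scal (- (1 / (1 - t\<^sup>2))) * gen Pod_z"

fun podles_to_fuzzy :: "real \<Rightarrow> podles_gen \<Rightarrow> fuzzy_gen free_algebra" where
  "podles_to_fuzzy t Pod_x = scal (1 - t\<^sup>2) * gen Fuz_a + scal (t\<^sup>2)"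
| "podles_to_fuzzy t Pod_z = scal (- (1 - t\<^sup>2)) * gen Fuz_b"

lemma fuzzy_rels_eq:
  defines "a \<equiv> gen Fuz_a" and "b \<equiv> gen Fuz_b"
  shows "fuzzy_rels q2 lam = 
    (let e = 1 + scal lam - scal q2 * a in
      {e * e + b * adj b - e, e * b + b * a - b, adj b * e + a * adj b - adj b,
       adj b * b + a * a - a, a - adj a})"
proof -
  have entries: "{f i j |i j. True} = {f 1 1, f 1 2, f 2 1, f 2 (2::2)}" for f :: "2 \<Rightarrow> 2 \<Rightarrow> 'a"
    using exhaust_2 by (auto, metis)
  show ?thesis
    unfolding fuzzy_rels_def Let_def entries
    by (simp add: fuzzy_free_e_def matrix_matrix_mult_def sum_2 a_def b_def)
qed

lemma fuzzy_to_podles_rels: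
  fixes Q t :: real
  assumes "t\<^sup>2 \<noteq> 1"
  defines "lam \<equiv> t\<^sup>2 * ((1 - Q) / (1 - t\<^sup>2))"
  assumes r: "r \<in> fuzzy_rels Q lam"
  shows "subst (fuzzy_to_podles t) r \<in> free_ideal (podles_rels Q (- (t\<^sup>2)))"
proof -
  \<comment> \<open>Writing t^2 as 1 - \<open>m\<close> leaves m n = 1 as the only relation between
    scalars, and as a rewrite rule it cancels all denominators.\<close>
  define k m n where "k = complex_of_real Q" and "m = complex_of_real (1 - t\<^sup>2)"
    and "n = complex_of_real (1 / (1 - t\<^sup>2))"
  note defs = this
  have mn: "m * n = 1"
    using assms(1) by (simp add: m_def n_def del: of_real_diff flip: of_real_mult)
  then have inv: "m * n = 1" "m * (n * x) = x" for x
    by (simp_all flip: mult.assoc)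
  have real: "cnj k = k" "cnj m = m" "cnj n = n"
    by (simp_all add: defs)
  let ?I = "free_ideal (podles_rels Q (- (t\<^sup>2)))"
  let ?f = "subst (fuzzy_to_podles t)"
  define a b where "a = gen Fuz_a" and "b = gen Fuz_b"
  note gens' = this
  define x z where "x = gen Pod_x" and "z = gen Pod_z"
  note gens = this
  define e where "e = 1 + scal ((1 - m) * (1 - k) * n) - scal k * a"
  define r1 where "r1 = x - adj x"
  define r2 where "r2 = z * x - scal k * x * z"
  define r3 where "r3 = z * adj z - (scal (m - 1) + scal k * x) * (1 - scal k * x)"
  define r4 where "r4 = adj z * z - (scal (m - 1) + x) * (1 - x)"
  note rels = r1_def r2_def r3_def r4_def
  have I: "r1 \<in> ?I" "r2 \<in> ?I" "r3 \<in> ?I" "r4 \<in> ?I"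
    by (rule free_ideal_gen, simp add: podles_rels_def rels gens defs Let_def)+
  have f: "?f a = scal n * x - scal ((1 - m) * n)" "?f b = scal (- n) * z"
    by (simp_all add: gens gens' defs)
  note norm = f e_def subst_simps rels algebra_simps gens scal_simps inv real
  have "?f (a - adj a) = scal n * r1"
    by (simp add: norm)
  also have "\<dots> \<in> ?I"
    by (intro free_ideal_closed I)
  finally have 1: "?f (a - adj a) \<in> ?I" .
  \<comment> \<open>The image of \<open>e\<close> is n (1 - k x), so that of
    \<open>e * e - e\<close> is -n^2 (m - 1 + k x)(1 - k x), the product subtracted in
    \<open>r3\<close>.\<close>
  have "?f (e * e + b * adj b - e) = scal (n * n) * r3"
    by (simp add: norm)
  also have "\<dots> \<in> ?I"
    by (intro free_ideal_closed I)
  finally have 2: "?f (e * e + b * adj b - e) \<in> ?I" .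
  \<comment> \<open>This determines \<open>lam\<close>: it is the value for which the terms linear
    in \<open>z\<close> cancel and only \<open>r2\<close> survives.\<close>
  have "?f (e * b + b * a - b) = scal (- (n * n)) * r2"
    by (simp add: norm)
  also have "\<dots> \<in> ?I"
    by (intro free_ideal_closed I)
  finally have 3: "?f (e * b + b * a - b) \<in> ?I" .
  \<comment> \<open>The adjoint of the previous entry, except that \<open>adj r2\<close> contains
    \<open>adj x\<close> where \<open>x\<close> is wanted; the two terms with \<open>r1\<close>
    replace it on either side of \<open>adj z\<close>.\<close>
  have "?f (adj b * e + a * adj b - adj b) =
      scal (- (n * n)) * (adj r2 + r1 * adj z - scal k * adj z * r1)"
    by (simp add: norm)
  also have "\<dots> \<in> ?I"
    by (intro free_ideal_closed I)
  finally have 4: "?f (adj b * e + a * adj b - adj b) \<in> ?I" .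
  have "?f (adj b * b + a * a - a) = scal (n * n) * r4"
    by (simp add: norm)
  also have "\<dots> \<in> ?I"
    by (intro free_ideal_closed I)
  finally have 5: "?f (adj b * b + a * a - a) \<in> ?I" .
  have "complex_of_real lam = (1 - m) * (1 - k) * n"
    by (simp add: lam_def defs)
  then have "fuzzy_rels Q lam = {e * e + b * adj b - e, e * b + b * a - b,
      adj b * e + a * adj b - adj b, adj b * b + a * a - a, a - adj a}"
    by (simp add: fuzzy_rels_eq Let_def e_def k_def gens')
  from r[unfolded this] show ?thesis
    using 1 2 3 4 5 by (elim insertE emptyE) (simp_all only:)
qed

text \<open>An invertible affine change of coordinates rescales relations: the factors n and n^2 of
  the opposite direction reappear here as m and m^2.\<close>

lemma podles_to_fuzzy_rels:
  fixes Q t :: real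
  assumes "t\<^sup>2 \<noteq> 1"
  defines "lam \<equiv> t\<^sup>2 * ((1 - Q) / (1 - t\<^sup>2))"
  assumes r: "r \<in> podles_rels Q (- (t\<^sup>2))"
  shows "subst (podles_to_fuzzy t) r \<in> free_ideal (fuzzy_rels Q lam)"
proof -
  define k m n where "k = complex_of_real Q" and "m = complex_of_real (1 - t\<^sup>2)"
    and "n = complex_of_real (1 / (1 - t\<^sup>2))"
  note defs = this
  have mn: "m * n = 1"
    using assms(1) by (simp add: m_def n_def del: of_real_diff flip: of_real_mult)
  then have inv: "m * n = 1" "m * (n * x) = x" for x
    by (simp_all flip: mult.assoc)
  have real: "cnj k = k" "cnj m = m" "cnj n = n"
    by (simp_all add: defs)
  have lam: "complex_of_real lam = (1 - m) * (1 - k) * n"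
    by (simp add: lam_def defs)
  let ?I = "free_ideal (fuzzy_rels Q lam)"
  let ?g = "subst (podles_to_fuzzy t)"
  define a b where "a = gen Fuz_a" and "b = gen Fuz_b"
  note gens = this
  define x z where "x = gen Pod_x" and "z = gen Pod_z"
  note gens' = this
  define e where "e = 1 + scal ((1 - m) * (1 - k) * n) - scal k * a"
  have I: "a - adj a \<in> ?I" "e * e + b * adj b - e \<in> ?I" "e * b + b * a - b \<in> ?I"
      "adj b * b + a * a - a \<in> ?I"
    by (rule free_ideal_gen, simp add: fuzzy_rels_eq Let_def e_def lam k_def gens)+
  have g: "?g x = scal m * a + scal (1 - m)" "?g z = scal (- m) * b"
    by (simp_all add: gens gens' defs)
  note norm = g e_def subst_simps algebra_simps gens scal_simps inv real
  have "?g (x - adj x) = scal m * (a - adj a)"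
    by (simp add: norm)
  also have "\<dots> \<in> ?I"
    by (intro free_ideal_mult_left I)
  finally have 1: "?g (x - adj x) \<in> ?I" .
  have "?g (z * x - scal k * x * z) = scal (- (m * m)) * (e * b + b * a - b)"
    by (simp add: norm)
  also have "\<dots> \<in> ?I"
    by (intro free_ideal_mult_left I)
  finally have 2: "?g (z * x - scal k * x * z) \<in> ?I" .
  have "?g (z * adj z - (scal (m - 1) + scal k * x) * (1 - scal k * x)) =
      scal (m * m) * (e * e + b * adj b - e)"
    by (simp add: norm)
  also have "\<dots> \<in> ?I"
    by (intro free_ideal_mult_left I)
  finally have 3: "?g (z * adj z - (scal (m - 1) + scal k * x) * (1 - scal k * x)) \<in> ?I" .
  have "?g (adj z * z - (scal (m - 1) + x) * (1 - x)) = scal (m * m) * (adj b * b + a * a - a)"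
    by (simp add: norm)
  also have "\<dots> \<in> ?I"
    by (intro free_ideal_mult_left I)
  finally have 4: "?g (adj z * z - (scal (m - 1) + x) * (1 - x)) \<in> ?I" .
  have "podles_rels Q (- (t\<^sup>2)) = {x - adj x, z * x - scal k * x * z,
      z * adj z - (scal (m - 1) + scal k * x) * (1 - scal k * x),
      adj z * z - (scal (m - 1) + x) * (1 - x)}"
    by (simp add: podles_rels_def Let_def gens' defs)
  from r[unfolded this] show ?thesis
    using 1 2 3 4 by (elim insertE emptyE) (simp_all only:)
qed

lemma fuzzy_podles_inverse:
  assumes "t\<^sup>2 \<noteq> 1"
  shows podles_to_fuzzy_to_podles: "subst (podles_to_fuzzy t) (fuzzy_to_podles t x) = gen x"
    and fuzzy_to_podles_to_fuzzy: "subst (fuzzy_to_podles t) (podles_to_fuzzy t y) = gen y"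
proof -
  define m n where "m = complex_of_real (1 - t\<^sup>2)" and "n = complex_of_real (1 / (1 - t\<^sup>2))"
  note defs = this
  have mn: "m * n = 1"
    using assms by (simp add: defs del: of_real_diff flip: of_real_mult)
  then have inv: "m * n = 1" "m * (n * c) = c" for c
    by (simp_all flip: mult.assoc)
  have "fuzzy_to_podles t Fuz_a = scal n * gen Pod_x - scal ((1 - m) * n)"
    "fuzzy_to_podles t Fuz_b = scal (- n) * gen Pod_z"
    "podles_to_fuzzy t Pod_x = scal m * gen Fuz_a + scal (1 - m)"
    "podles_to_fuzzy t Pod_z = scal (- m) * gen Fuz_b"
    by (simp_all add: defs)
  note norm = this subst_simps algebra_simps scal_simps inv
  show "subst (podles_to_fuzzy t) (fuzzy_to_podles t x) = gen x"
    by (cases x) (simp_all add: norm del: fuzzy_to_podles.simps podles_to_fuzzy.simps)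
  show "subst (fuzzy_to_podles t) (podles_to_fuzzy t y) = gen y"
    by (cases y) (simp_all add: norm del: fuzzy_to_podles.simps podles_to_fuzzy.simps)
qed

section \<open>The time slice as a single presentation, and the image of the projector\<close>

definition slice_proj :: "real \<Rightarrow> real \<Rightarrow> hyp_gen free_algebra \<Rightarrow> hyp_gen free_algebra set set" where
  "slice_proj q t p =
    star_proj (BqSU2 q) (slice_rels q t) (star_proj free_star_algebra (hyp_rels q) p)"

text \<open>This collapses the twofold quotient, so that \<open>presents_iso\<close> and
  \<open>presents_eq_iff\<close> apply to the time slice as to the two spheres.\<close>

lemma presents_time_slice:
  "presents (time_slice q t) (hyp_rels q \<union> {slice_rel q t}) (slice_proj q t)"
proof -
  interpret F: star_algebra free_star_algebra
    by (rule free_star_algebra)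
  let ?p = "star_proj free_star_algebra (hyp_rels q)"
  have B: "presents (BqSU2 q) (hyp_rels q) ?p"
    unfolding BqSU2_def by (rule presents_presented)
  then have p: "star_algebra (BqSU2 q)" "?p \<in> star_hom free_star_algebra (BqSU2 q)"
      "range ?p = carrier (BqSU2 q)"
    by (simp_all add: presents_def)
  interpret B: star_algebra "BqSU2 q" by fact
  have u: "BqSU2_u q $ 1 $ 1 = ?p (gen Hyp_alpha)" "BqSU2_u q $ 2 $ 2 = ?p (gen Hyp_delta)"
    by (simp_all add: BqSU2_u_def Let_def)
  \<comment> \<open>The simplifier must not erase the factor \<open>1\<close> of
    \<open>slice_rel\<close>: its image is the unit that \<open>slice_rels\<close> multiplies by t +
    1/t.\<close>
  have rels: "slice_rels q t = ?p ` {slice_rel q t}"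
    by (simp add: slice_rels_def Tr_q_def slice_rel_def u presents_add[OF B] presents_diff[OF B]
        presents_scal[OF B] presents_one[OF B] del: mult_1_right)
  have R: "slice_rels q t \<subseteq> carrier (BqSU2 q)"
    using p(3) by (auto simp: rels)
  have "slice_proj q t = star_proj (BqSU2 q) (slice_rels q t) \<circ> ?p"
    by (simp add: slice_proj_def fun_eq_iff)
  moreover have "star_proj (BqSU2 q) (slice_rels q t) \<circ> ?p \<in> star_hom free_star_algebra (time_slice q t)"
    unfolding time_slice_def by (rule star_hom_comp[OF p(2) B.star_proj_hom[OF R]])
  moreover have "range (slice_proj q t) = carrier (time_slice q t)"
    unfolding time_slice_def B.carrier_star_quotient
    by (simp add: slice_proj_def flip: p(3) image_image)
  moreover have "slice_proj q t r = \<zero>\<^bsub>time_slice q t\<^esub> \<longleftrightarrow>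
      r \<in> free_ideal (hyp_rels q \<union> {slice_rel q t})" for r
    using star_quotient_quotient_kernel[OF free_star_algebra, of "hyp_rels q" "{slice_rel q t}" r]
    by (simp add: slice_proj_def time_slice_def rels BqSU2_def presented_star_algebra_def)
  ultimately show ?thesis
    using time_slice_star_algebra unfolding presents_def by metis
qed

text \<open>Three entries agree already in the free algebra. The lower right one is the image of
  \<open>Fuz_a\<close>, a polynomial in \<alpha>, and has to be compared with an expression in
  \<delta>; this costs a multiple of the slice relation.\<close>

lemma fuzzy_e_image:
  fixes q t :: real
  assumes "q \<noteq> 0" and "t \<noteq> 0" and "t\<^sup>2 \<noteq> 1"
  defines "lam \<equiv> t\<^sup>2 * ((1 - q\<^sup>2) / (1 - t\<^sup>2))"
    and "u \<equiv> vector [vector [gen Hyp_alpha, gen Hyp_beta],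
                     vector [adj (gen Hyp_beta), gen Hyp_delta]] :: hyp_gen free_algebra ^ 2 ^ 2"
  shows "subst (podles_to_slice q t) (subst (fuzzy_to_podles t) (fuzzy_free_e (q\<^sup>2) lam $ i $ j))
      - scal (1 / (1 - t\<^sup>2)) * ((if i = j then 1 else 0) - scal (q * t) * u $ i $ j)
    \<in> free_ideal (hyp_rels q \<union> {slice_rel q t})"
proof -
  define a b c d n where "a = complex_of_real q" and "b = complex_of_real (inverse q)"
    and "c = complex_of_real t" and "d = complex_of_real (inverse t)"
    and "n = complex_of_real (1 / (1 - t\<^sup>2))"
  note defs = this
  have inv: "a * b = 1" "a * (b * x) = x" "c * d = 1" "c * (d * x) = x" for x
    using assms(1,2) by (simp_all add: defs)
  \<comment> \<open>Used as a rewrite rule, t^2/(1 - t^2) = 1/(1 - t^2) - 1 removes every t^2 that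
    stands next to \<open>n\<close>.\<close>
  have "c * (c * (1 / (1 - c * c))) = 1 / (1 - c * c) - 1" if "c * c \<noteq> 1"
    using that by (simp add: field_simps)
  moreover have "c * c \<noteq> 1"
    using assms(3) unfolding defs of_real_mult[symmetric] of_real_eq_1_iff by (simp add: power2_eq_square)
  ultimately have n: "c * (c * n) = n - 1"
    by (simp add: defs power2_eq_square)
  have lam: "complex_of_real lam = c * c * (1 - a * a) * n"
    by (simp add: lam_def defs power2_eq_square)
  let ?I = "free_ideal (hyp_rels q \<union> {slice_rel q t})"
  let ?h = "\<lambda>p. subst (podles_to_slice q t) (subst (fuzzy_to_podles t) p)"
  have h: "?h (gen Fuz_a) = scal (n * (c * b)) * gen Hyp_alpha - scal (c * c * n)"
    "?h (gen Fuz_b) = scal (- (n * (a * c))) * gen Hyp_beta"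
    by (simp_all add: defs subst_simps scal_scal power2_eq_square mult_ac)
  have real: "cnj a = a" "cnj c = c" "cnj n = n"
    by (simp_all add: defs)
  have s: "slice_rel q t = scal b * gen Hyp_alpha + scal a * gen Hyp_delta - (scal c + scal d)"
    by (simp add: slice_rel_def defs scal_add)
  have e: "fuzzy_free_e (q\<^sup>2) lam $ 1 $ 1 = 1 + scal (c * c * (1 - a * a) * n) - scal (a * a) * gen Fuz_a"
    "fuzzy_free_e (q\<^sup>2) lam $ 1 $ 2 = gen Fuz_b"
    "fuzzy_free_e (q\<^sup>2) lam $ 2 $ 1 = adj (gen Fuz_b)"
    "fuzzy_free_e (q\<^sup>2) lam $ 2 $ 2 = gen Fuz_a"
    by (simp_all add: fuzzy_free_e_def lam) (simp add: a_def power2_eq_square)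
  \<comment> \<open>Here 1 + lam = (1 - q^2 t^2)/(1 - t^2), so the entry becomes (1 - q^2 x)/(1 -
    t^2), and q^2 x is q t \<alpha>.\<close>
  have 11: "?h (1 + scal (c * c * (1 - a * a) * n) - scal (a * a) * gen Fuz_a) =
      scal n * (1 - scal (a * c) * gen Hyp_alpha)"
    unfolding subst_simps h subst_scal subst_one by (simp add: scal_simps algebra_simps inv n)
  have 12: "?h (gen Fuz_b) = - (scal n * (scal (a * c) * gen Hyp_beta))"
    unfolding h by (simp add: scal_simps)
  have 21: "?h (adj (gen Fuz_b)) = - (scal n * (scal (a * c) * adj (gen Hyp_beta)))"
    unfolding subst_adj h by (simp add: subst_simps scal_simps real)
  have "?h (gen Fuz_a) - scal n * (1 - scal (a * c) * gen Hyp_delta) = scal (n * c) * slice_rel q t"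
    unfolding h s by (simp add: scal_simps algebra_simps inv n)
  then have 22: "?h (gen Fuz_a) - scal n * (1 - scal (a * c) * gen Hyp_delta) \<in> ?I"
    by (simp add: free_ideal_mult_left free_ideal_gen)
  have "?h (fuzzy_free_e (q\<^sup>2) lam $ i $ j) - scal n * ((if i = j then 1 else 0) - scal (a * c) * u $ i $ j) \<in> ?I"
    using exhaust_2[of i] exhaust_2[of j] 22
    by (elim disjE) (simp_all only: e 11 12 21, simp_all add: u_def free_ideal_zero)
  then show ?thesis
    by (simp only: defs of_real_mult)
qed

text \<open>The map \<psi> is taken as \<phi> after \<theta>, where \<theta> is the q-fuzzy
  presentation of the Podles sphere. The formula for the projector thus refers to the same
  isomorphism \<phi> as the first claim.\<close>

theorem proposition4:
  fixes q t :: real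
  assumes "q \<noteq> 0" and "t \<noteq> 0"
  shows "(\<exists>\<phi>. \<phi> \<in> star_algebra_iso (podles_sphere (q\<^sup>2) (- (t\<^sup>2))) (time_slice q t)) \<and>
    (t\<^sup>2 \<noteq> 1 \<longrightarrow>
      (let T = time_slice q t; u = time_slice_u q t;
           lam = t\<^sup>2 * ((1 - q\<^sup>2) / (1 - t\<^sup>2))
       in \<exists>\<psi>. \<psi> \<in> star_algebra_iso (fuzzy_sphere (q\<^sup>2) lam) T \<and>
            (\<forall>i j. \<psi> (fuzzy_e (q\<^sup>2) lam $ i $ j) =
               complex_of_real (1 / (1 - t\<^sup>2)) \<odot>\<^bsub>T\<^esub>
                 ((if i = j then \<one>\<^bsub>T\<^esub> else \<zero>\<^bsub>T\<^esub>) \<ominus>\<^bsub>T\<^esub> complex_of_real (q * t) \<odot>\<^bsub>T\<^esub> (u $ i $ j)))))"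
proof -
  let ?T = "time_slice q t" and ?P = "podles_sphere (q\<^sup>2) (- (t\<^sup>2))"
  let ?\<pi> = "star_proj free_star_algebra (podles_rels (q\<^sup>2) (- (t\<^sup>2)))"
  note T = presents_time_slice[of q t]
  have P: "presents ?P (podles_rels (q\<^sup>2) (- (t\<^sup>2))) ?\<pi>"
    unfolding podles_sphere_def by (rule presents_presented)
  obtain \<phi> where \<phi>: "\<phi> \<in> star_algebra_iso ?P ?T"
      "\<And>p. \<phi> (?\<pi> p) = slice_proj q t (subst (podles_to_slice q t) p)"
  proof (rule presents_iso[OF P T, of "podles_to_slice q t" "slice_to_podles q t"])
    show "subst (slice_to_podles q t) (podles_to_slice q t x) - gen x
        \<in> free_ideal (podles_rels (q\<^sup>2) (- (t\<^sup>2)))" for x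
      using assms by (simp add: podles_to_slice_to_podles free_ideal_zero)
  qed (use assms in \<open>blast intro: podles_to_slice_rels slice_to_podles_rels slice_to_podles_to_slice\<close>)+
  have "\<exists>\<psi>. \<psi> \<in> star_algebra_iso (fuzzy_sphere (q\<^sup>2) lam) ?T \<and>
      (\<forall>i j. \<psi> (fuzzy_e (q\<^sup>2) lam $ i $ j) = complex_of_real (1 / (1 - t\<^sup>2)) \<odot>\<^bsub>?T\<^esub>
        ((if i = j then \<one>\<^bsub>?T\<^esub> else \<zero>\<^bsub>?T\<^esub>) \<ominus>\<^bsub>?T\<^esub>
          complex_of_real (q * t) \<odot>\<^bsub>?T\<^esub> (time_slice_u q t $ i $ j)))"
    if t: "t\<^sup>2 \<noteq> 1" and lam: "lam = t\<^sup>2 * ((1 - q\<^sup>2) / (1 - t\<^sup>2))" for lam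
  proof -
    let ?\<rho> = "star_proj free_star_algebra (fuzzy_rels (q\<^sup>2) lam)"
    have F: "presents (fuzzy_sphere (q\<^sup>2) lam) (fuzzy_rels (q\<^sup>2) lam) ?\<rho>"
      unfolding fuzzy_sphere_def by (rule presents_presented)
    obtain \<theta> where \<theta>: "\<theta> \<in> star_algebra_iso (fuzzy_sphere (q\<^sup>2) lam) ?P"
        "\<And>p. \<theta> (?\<rho> p) = ?\<pi> (subst (fuzzy_to_podles t) p)"
    proof (rule presents_iso[OF F P, of "fuzzy_to_podles t" "podles_to_fuzzy t"])
      show "subst (podles_to_fuzzy t) (fuzzy_to_podles t x) - gen x \<in> free_ideal (fuzzy_rels (q\<^sup>2) lam)"
        and "subst (fuzzy_to_podles t) (podles_to_fuzzy t y) - gen y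
          \<in> free_ideal (podles_rels (q\<^sup>2) (- (t\<^sup>2)))" for x y
        using t by (simp_all add: fuzzy_podles_inverse free_ideal_zero)
    qed (blast intro: fuzzy_to_podles_rels[OF t, of _ "q\<^sup>2", folded lam]
        podles_to_fuzzy_rels[OF t, of _ "q\<^sup>2", folded lam])+
    let ?u = "vector [vector [gen Hyp_alpha, gen Hyp_beta],
      vector [adj (gen Hyp_beta), gen Hyp_delta]] :: hyp_gen free_algebra ^ 2 ^ 2"
    have u: "time_slice_u q t $ i $ j = slice_proj q t (?u $ i $ j)" for i j
      by (simp add: time_slice_u_def BqSU2_u_def slice_proj_def)
    have "(\<phi> \<circ> \<theta>) (fuzzy_e (q\<^sup>2) lam $ i $ j) = complex_of_real (1 / (1 - t\<^sup>2)) \<odot>\<^bsub>?T\<^esub>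
        ((if i = j then \<one>\<^bsub>?T\<^esub> else \<zero>\<^bsub>?T\<^esub>) \<ominus>\<^bsub>?T\<^esub>
          complex_of_real (q * t) \<odot>\<^bsub>?T\<^esub> (time_slice_u q t $ i $ j))" for i j
    proof -
      have "(\<phi> \<circ> \<theta>) (fuzzy_e (q\<^sup>2) lam $ i $ j) = slice_proj q t (subst (podles_to_slice q t)
          (subst (fuzzy_to_podles t) (fuzzy_free_e (q\<^sup>2) lam $ i $ j)))"
        by (simp add: fuzzy_e_def \<phi>(2) \<theta>(2))
      \<comment> \<open>The representatives differ in general; \<open>fuzzy_e_image\<close> puts
        their difference in the ideal, and \<open>presents_eq_iff\<close> turns this into an
        equation in the time slice.\<close>
      also have "\<dots> = slice_proj q t
          (scal (1 / (1 - t\<^sup>2)) * ((if i = j then 1 else 0) - scal (q * t) * ?u $ i $ j))"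
        unfolding presents_eq_iff[OF T] lam by (rule fuzzy_e_image[OF assms t])
      also have "\<dots> = complex_of_real (1 / (1 - t\<^sup>2)) \<odot>\<^bsub>?T\<^esub>
          (slice_proj q t (if i = j then 1 else 0) \<ominus>\<^bsub>?T\<^esub>
            complex_of_real (q * t) \<odot>\<^bsub>?T\<^esub> (time_slice_u q t $ i $ j))"
        by (simp only: u presents_scal[OF T] presents_diff[OF T])
      also have "slice_proj q t (if i = j then 1 else 0) = (if i = j then \<one>\<^bsub>?T\<^esub> else \<zero>\<^bsub>?T\<^esub>)"
        by (simp add: presents_one[OF T] presents_zero[OF T])
      finally show ?thesis .
    qed
    then show ?thesis
      using star_algebra_iso_trans[OF \<theta>(1) \<phi>(1)] by blast
  qed
  then show ?thesis
    using \<phi>(1) unfolding Let_def by blast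
qed

end
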